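(* Let $\mathcal{H}$ be a complex Hilbert space, let $A$ be a positive bounded linear operator on $\mathcal{H}$, and let $T\in\mathcal{B}_A(\mathcal{H})$. Then $$\tfrac14\|T^{\sharp_A}T+TT^{\sharp_A}\|_A\le\omega_A^2(T)\le\tfrac12\|T^{\sharp_A}T+TT^{\sharp_A}\|_A .$$ Moreover, both inequalities are sharp, i.e. the constants $\tfrac14$ and $\tfrac12$ are best possible: $\tfrac14$ cannot be replaced by a larger constant, and $\tfrac12$ cannot be replaced by a smaller constant, for the respective inequality to hold for all complex Hilbert spaces $\mathcal{H}$, all positive bounded linear operators $A$ on $\mathcal{H}$ and all $T\in\mathcal{B}_A(\mathcal{H})$.
   Context: $\mathcal{B}(\mathcal{H})$ denotes the bounded linear operators on the complex Hilbert space $(\mathcal{H},\langle\cdot\mid\cdot\rangle)$. $A\in\mathcal{B}(\mathcal{H})$ is positive, meaning $\langle Ax\mid x\rangle\ge 0$ for all $x$. Put $\langle x\mid y\rangle_A=\langle Ax\mid y\rangle$ and $\|x\|_A=\sqrt{\langle x\mid x\rangle_A}$. $\mathcal{B}_A(\mathcal{H})$ is the set of $T\in\mathcal{B}(\mathcal{H})$ for which there is $S\in\mathcal{B}(\mathcal{H})$ with $AS=T^*A$ (equivalently $\mathcal{R}(T^*A)\subseteq\mathcal{R}(A)$, where $\mathcal{R}$ denotes range). For $T\in\mathcal{B}_A(\mathcal{H})$, $T^{\sharp_A}$ is the unique $S\in\mathcal{B}(\mathcal{H})$ with $AS=T^*A$ and $\mathcal{R}(S)\subseteq\overline{\mathcal{R}(A)}$.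 The $A$-operator seminorm is $\|T\|_A=\sup\{\|Tx\|_A: x\in\mathcal{H},\ \|x\|_A=1\}$ and the $A$-numerical radius is $\omega_A(T)=\sup\{|\langle Tx\mid x\rangle_A|: x\in\mathcal{H},\ \|x\|_A=1\}$; both are finite for $T\in\mathcal{B}_A(\mathcal{H})$. *)

theory Defs
  imports "HOL-Analysis.Analysis" "HOL-Library.Function_Algebras"
begin

text \<open>
  Complex Hilbert spaces are given by a carrier: \<open>H\<close> is a linear subspace of some complex vector
  space, namely a type of class \<open>ab_group_add\<close> with a scalar multiplication \<open>scale\<close>, and \<open>ip\<close> is an
  inner product on \<open>H\<close>. The choice \<open>H = UNIV\<close> is included. Having the space as a term, not as a
  type, makes it possible to quantify over Hilbert spaces inside a formula. Inner products
  are linear in the first argument; the values of \<open>ip\<close> outside of \<open>H\<close> are irrelevant.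

  A quantifier over all Hilbert spaces within a formula needs a fixed ambient type. We use
  \<open>nat \<Rightarrow> complex\<close> (pointwise addition from \<^theory>\<open>HOL-Library.Function_Algebras\<close>), which contains
  an isomorphic copy of every separable complex Hilbert space.
\<close>

locale complex_inner_space = vector_space scale
  for scale :: "complex \<Rightarrow> 'a::ab_group_add \<Rightarrow> 'a" +
  fixes H :: "'a set"
    and ip :: "'a \<Rightarrow> 'a \<Rightarrow> complex"
  assumes subspace_H: "subspace H"
    and ip_add_left: "\<lbrakk>x \<in> H; y \<in> H; z \<in> H\<rbrakk> \<Longrightarrow> ip (x + y) z = ip x z + ip y z"
    and ip_scale_left: "\<lbrakk>x \<in> H; y \<in> H\<rbrakk> \<Longrightarrow> ip (scale c x) y = c * ip x y"
    and ip_commute: "\<lbrakk>x \<in> H; y \<in> H\<rbrakk> \<Longrightarrow> ip y x = cnj (ip x y)"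
    and ip_ge_zero: "x \<in> H \<Longrightarrow> ip x x \<in> \<real>\<^sub>\<ge>\<^sub>0"
    and ip_eq_zero: "\<lbrakk>x \<in> H; ip x x = 0\<rbrakk> \<Longrightarrow> x = 0"
begin

definition hnorm :: "'a \<Rightarrow> real" where
  "hnorm x = sqrt (Re (ip x x))"

text \<open>The guard is needed because \<^locale>\<open>Metric_space\<close> asks for symmetry and nonnegativity of the
  distance also outside of the carrier.\<close>

definition hdist :: "'a \<Rightarrow> 'a \<Rightarrow> real" where
  "hdist x y = (if x \<in> H \<and> y \<in> H then hnorm (x - y) else 0)"

lemma H_closed:
  "0 \<in> H" "\<lbrakk>x \<in> H; y \<in> H\<rbrakk> \<Longrightarrow> x + y \<in> H" "\<lbrakk>x \<in> H; y \<in> H\<rbrakk> \<Longrightarrow> x - y \<in> H"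
  "x \<in> H \<Longrightarrow> scale c x \<in> H"
  using subspace_H by (auto intro: subspace_0 subspace_add subspace_diff subspace_scale)

lemma ip_add_right: "\<lbrakk>x \<in> H; y \<in> H; z \<in> H\<rbrakk> \<Longrightarrow> ip z (x + y) = ip z x + ip z y"
  by (metis H_closed(2) complex_cnj_add ip_add_left ip_commute)

lemma ip_scale_right: "\<lbrakk>x \<in> H; y \<in> H\<rbrakk> \<Longrightarrow> ip y (scale c x) = cnj c * ip y x"
  by (metis H_closed(4) complex_cnj_mult ip_commute ip_scale_left)

lemma ip_self: "x \<in> H \<Longrightarrow> ip x x = of_real (Re (ip x x))" "x \<in> H \<Longrightarrow> Re (ip x x) \<ge> 0"
  using ip_ge_zero[of x] by (auto simp: nonneg_Reals_def)

lemma cauchy_schwarz: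
  assumes x: "x \<in> H" and y: "y \<in> H"
  shows "cmod (ip x y) \<le> hnorm x * hnorm y"
proof (cases "y = 0")
  case True
  have "ip x (scale 0 y) = cnj 0 * ip x y"
    by (rule ip_scale_right[OF y x])
  then show ?thesis
    using True ip_self(2)[OF x] ip_self(2)[OF y] by (simp add: hnorm_def)
next
  case False
  define a b c where "a = Re (ip x x)" and "b = ip x y" and "c = Re (ip y y)"
  have "c \<noteq> 0"
    using ip_self(1)[OF y] ip_eq_zero[OF y] False unfolding c_def by (metis of_real_0)
  then have c: "c > 0"
    using ip_self(2)[OF y] by (simp add: c_def)
  have xx: "ip x x = of_real a"
    unfolding a_def by (rule ip_self(1)[OF x])
  have yy: "ip y y = of_real c"
    unfolding c_def by (rule ip_self(1)[OF y])
  have yx: "ip y x = cnj b"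
    unfolding b_def by (rule ip_commute[OF x y])
  define k where "k = - b / of_real c"
  define z where "z = x + scale k y"
  have z: "z \<in> H"
    using x y by (simp add: z_def H_closed)
  have "ip z z = of_real a + cnj k * b + k * cnj b + k * cnj k * of_real c"
    using x y by (simp add: z_def H_closed ip_add_left ip_add_right ip_scale_left ip_scale_right
        xx yy yx b_def[symmetric] algebra_simps)
  also have "\<dots> = of_real a - b * cnj b / of_real c"
    using c by (simp add: k_def field_simps)
  also have "\<dots> = of_real (a - (cmod b)\<^sup>2 / c)"
    using complex_norm_square[of b] by simp
  finally have "a - (cmod b)\<^sup>2 / c \<ge> 0"
    using ip_self(2)[OF z] by (metis Re_complex_of_real)
  then have "(cmod b)\<^sup>2 \<le> a * c"
    using c by (simp add: field_simps)
  then show ?thesis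
    by (simp add: hnorm_def a_def b_def c_def real_le_rsqrt flip: real_sqrt_mult)
qed

lemma hnorm_triangle:
  assumes x: "x \<in> H" and y: "y \<in> H"
  shows "hnorm (x + y) \<le> hnorm x + hnorm y"
proof (rule power2_le_imp_le)
  have "(hnorm (x + y))\<^sup>2 = (hnorm x)\<^sup>2 + (hnorm y)\<^sup>2 + 2 * Re (ip x y)"
    using x y ip_self(2)[of x] ip_self(2)[of y] ip_self(2)[of "x + y"] ip_commute[OF x y]
    by (simp add: hnorm_def H_closed ip_add_left ip_add_right)
  moreover have "Re (ip x y) \<le> hnorm x * hnorm y"
    using cauchy_schwarz[OF x y] complex_Re_le_cmod order_trans by blast
  ultimately show "(hnorm (x + y))\<^sup>2 \<le> (hnorm x + hnorm y)\<^sup>2"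
    by (simp add: power2_sum)
  show "0 \<le> hnorm x + hnorm y"
    using x y by (simp add: hnorm_def ip_self(2))
qed

lemma hnorm_minus_commute:
  assumes x: "x \<in> H" and y: "y \<in> H"
  shows "hnorm (x - y) = hnorm (y - x)"
proof -
  have "y - x = scale (-1) (x - y)"
    by simp
  moreover have "ip (scale (-1) (x - y)) (scale (-1) (x - y)) = ip (x - y) (x - y)"
    using x y by (simp add: H_closed(3) H_closed(4) ip_scale_left ip_scale_right
        del: scale_minus_left scale_one)
  ultimately show ?thesis
    by (simp add: hnorm_def)
qed

sublocale hmet: Metric_space H hdist
proof
  fix x y z
  show "0 \<le> hdist x y"
    by (simp add: hdist_def hnorm_def H_closed ip_self(2))
  show "hdist x y = hdist y x"
    using hnorm_minus_commute by (simp add: hdist_def)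
  show "hdist x y = 0 \<longleftrightarrow> x = y" if "x \<in> H" "y \<in> H"
  proof -
    have "ip 0 0 = 0"
      using ip_scale_left[OF H_closed(1,1), of 0] by simp
    moreover have "x - y = 0" if "Re (ip (x - y) (x - y)) = 0"
      using that ip_eq_zero ip_self(1) H_closed(3)[OF \<open>x \<in> H\<close> \<open>y \<in> H\<close>] by (metis of_real_0)
    ultimately show ?thesis
      using that by (auto simp: hdist_def hnorm_def)
  qed
  show "hdist x z \<le> hdist x y + hdist y z" if "x \<in> H" "y \<in> H" "z \<in> H"
    using that hnorm_triangle[of "x - y" "y - z"] by (simp add: hdist_def H_closed)
qed

end

locale complex_hilbert_space = complex_inner_space +
  assumes complete: "hmet.mcomplete"
begin

text \<open>Operators are extensional functions on \<open>H\<close>, so that two operators are equal as soon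
  as they agree on \<open>H\<close>.\<close>

definition bounded_op :: "('a \<Rightarrow> 'a) set" where
  "bounded_op = {T \<in> H \<rightarrow>\<^sub>E H.
     (\<forall>x\<in>H. \<forall>y\<in>H. T (x + y) = T x + T y) \<and>
     (\<forall>c. \<forall>x\<in>H. T (scale c x) = scale c (T x)) \<and>
     (\<exists>K. \<forall>x\<in>H. hnorm (T x) \<le> K * hnorm x)}"

definition positive_op :: "('a \<Rightarrow> 'a) set" where
  "positive_op = {A \<in> bounded_op. \<forall>x\<in>H. ip (A x) x \<in> \<real>\<^sub>\<ge>\<^sub>0}"

definition adjoint_op :: "('a \<Rightarrow> 'a) \<Rightarrow> 'a \<Rightarrow> 'a" where
  "adjoint_op T = (THE S. S \<in> bounded_op \<and> (\<forall>x\<in>H. \<forall>y\<in>H. ip (T x) y = ip x (S y)))"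

definition A_ip :: "('a \<Rightarrow> 'a) \<Rightarrow> 'a \<Rightarrow> 'a \<Rightarrow> complex" where
  "A_ip A x y = ip (A x) y"

definition A_norm :: "('a \<Rightarrow> 'a) \<Rightarrow> 'a \<Rightarrow> real" where
  "A_norm A x = sqrt (Re (A_ip A x x))"

definition A_bounded_op :: "('a \<Rightarrow> 'a) \<Rightarrow> ('a \<Rightarrow> 'a) set" where
  "A_bounded_op A = {T \<in> bounded_op. \<exists>S\<in>bounded_op. \<forall>x\<in>H. A (S x) = adjoint_op T (A x)}"

definition A_adjoint :: "('a \<Rightarrow> 'a) \<Rightarrow> ('a \<Rightarrow> 'a) \<Rightarrow> 'a \<Rightarrow> 'a" where
  "A_adjoint A T = (THE S. S \<in> bounded_op \<and> (\<forall>x\<in>H. A (S x) = adjoint_op T (A x)) \<and>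
     S ` H \<subseteq> hmet.mtopology closure_of (A ` H))"

text \<open>The suprema range over sets of nonnegative reals, so the supremum of the empty set, which
  occurs exactly for \<open>A = 0\<close>, is \<open>0\<close>. The library leaves \<open>Sup {}\<close> unspecified on the reals.\<close>

definition A_op_norm :: "('a \<Rightarrow> 'a) \<Rightarrow> ('a \<Rightarrow> 'a) \<Rightarrow> real" where
  "A_op_norm A T =
     (if \<exists>x\<in>H. A_norm A x = 1 then Sup {A_norm A (T x) | x. x \<in> H \<and> A_norm A x = 1} else 0)"

definition A_num_radius :: "('a \<Rightarrow> 'a) \<Rightarrow> ('a \<Rightarrow> 'a) \<Rightarrow> real" where
  "A_num_radius A T =
     (if \<exists>x\<in>H. A_norm A x = 1 then Sup {cmod (A_ip A (T x) x) | x. x \<in> H \<and> A_norm A x = 1} else 0)"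

text \<open>The operator \<open>S T + T S\<close> with \<open>S\<close> the \<open>A\<close>-adjoint of \<open>T\<close>.\<close>

definition A_anticomm :: "('a \<Rightarrow> 'a) \<Rightarrow> ('a \<Rightarrow> 'a) \<Rightarrow> 'a \<Rightarrow> 'a" where
  "A_anticomm A T = (\<lambda>x\<in>H. A_adjoint A T (T x) + T (A_adjoint A T x))"

end

end

theory Submission
  imports Defs
begin

text \<open>
  Both inequalities follow from computations with the positive semidefinite form \<open>\<langle>x | y\<rangle>\<^sub>A\<close>. Let \<open>S\<close> be the \<open>A\<close>-adjoint of \<open>T\<close>; the two are adjoint to each other with respect
  to this form (\<open>adjoint_pair_A_adjoint\<close>).

  For the upper bound let \<open>x\<close> have seminorm 1. By Cauchy--Schwarz \<open>\<bar>\<langle>Tx | x\<rangle>\<^sub>A\<bar> = \<bar>\<langle>x | Sx\<rangle>\<^sub>A\<bar>\<close> is at most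
  \<open>\<parallel>Tx\<parallel>\<^sub>A\<close> and at most \<open>\<parallel>Sx\<parallel>\<^sub>A\<close>. Averaging the squares of these two estimates gives half of
  \<open>\<parallel>Tx\<parallel>\<^sub>A\<^sup>2 + \<parallel>Sx\<parallel>\<^sub>A\<^sup>2 = \<langle>(ST + TS)x | x\<rangle>\<^sub>A\<close> (\<open>form_sq_le_anticomm\<close>).

  For the lower bound put \<open>B = T + S\<close> and \<open>E = T - S\<close>. Then \<open>B\<close> and \<open>iE\<close> are symmetric for the form,
  and their quadratic forms are bounded by \<open>2\<omega>\<close>. For a symmetric operator a bound on the quadratic
  form is a bound on the operator seminorm (\<open>symmetric_bound_of_form_bound\<close>). As
  \<open>2(ST + TS) = B\<^sup>2 - E\<^sup>2\<close>, it follows that \<open>2\<parallel>ST + TS\<parallel>\<^sub>A \<le> (2\<omega>)\<^sup>2 + (2\<omega>)\<^sup>2\<close> (\<open>anticomm_le_form_sq\<close>).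

  Suprema on the reals say nothing unless the sets are bounded. So it has to be known that \<open>T\<close> is
  bounded for the seminorm, which is not obvious, since the seminorm and the norm are in general not
  equivalent. The reason is that \<open>ST\<close> is symmetric for the form: \<open>n \<mapsto> \<parallel>(ST)\<^sup>n x\<parallel>\<^sub>A\<close> is then log-convex,
  so a first quotient larger than \<open>\<parallel>ST\<parallel>\<close> would force a growth faster than the powers of \<open>\<parallel>ST\<parallel>\<close> allow
  (\<open>symmetric_bound_of_growth\<close>, \<open>A_norm_bound\<close>).

  Adjoints and \<open>A\<close>-adjoints are defined by description, so their existence has to be proved. Both
  come from one statement: a bounded linear map from a closed subspace \<open>M\<close> into \<open>H\<close> has an adjoint
  from \<open>H\<close> to \<open>M\<close> (\<open>adjoint_from_closed_subspace\<close>). For \<open>M = H\<close> this is the usual adjoint; for the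
  inclusion of \<open>M\<close> it is the orthogonal projection onto \<open>M\<close>. If \<open>A S\<^sub>0 = T\<^sup>* A\<close>, then \<open>S\<^sub>0\<close> followed by the
  projection onto the closure of the range of \<open>A\<close> is the \<open>A\<close>-adjoint, because \<open>A\<close> vanishes on the
  orthogonal complement of its range.

  Both constants are attained on the two-dimensional space with \<open>A = I\<close>: the nilpotent shift has
  numerical radius \<open>1/2\<close> and \<open>ST + TS = I\<close>, while \<open>T = I\<close> has numerical radius \<open>1\<close> and \<open>ST + TS = 2I\<close>.
\<close>

section \<open>Semi-inner products\<close>

text \<open>The form is only semidefinite: for a positive operator \<open>A\<close> with nontrivial kernel the map
  \<open>\<lambda>x y. \<langle>Ax | y\<rangle>\<close> satisfies these axioms and is not an inner product.\<close>

locale complex_semi_inner_space = vector_space scale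
  for scale :: "complex \<Rightarrow> 'a::ab_group_add \<Rightarrow> 'a" +
  fixes H :: "'a set"
    and g :: "'a \<Rightarrow> 'a \<Rightarrow> complex"
  assumes subspace_H: "subspace H"
    and add_left: "\<lbrakk>x \<in> H; y \<in> H; z \<in> H\<rbrakk> \<Longrightarrow> g (x + y) z = g x z + g y z"
    and scale_left: "\<lbrakk>x \<in> H; y \<in> H\<rbrakk> \<Longrightarrow> g (scale c x) y = c * g x y"
    and commute: "\<lbrakk>x \<in> H; y \<in> H\<rbrakk> \<Longrightarrow> g y x = cnj (g x y)"
    and ge_zero: "x \<in> H \<Longrightarrow> g x x \<in> \<real>\<^sub>\<ge>\<^sub>0"
begin

definition snorm :: "'a \<Rightarrow> real" where
  "snorm x = sqrt (Re (g x x))"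

text \<open>A relation between two operators, because for a degenerate form neither of them determines the
  other one.\<close>

definition adjoint_pair :: "('a \<Rightarrow> 'a) \<Rightarrow> ('a \<Rightarrow> 'a) \<Rightarrow> bool" where
  "adjoint_pair T S \<longleftrightarrow> T \<in> H \<rightarrow> H \<and> S \<in> H \<rightarrow> H \<and> (\<forall>x\<in>H. \<forall>y\<in>H. g (T x) y = g x (S y))"

lemma H_closed:
  "0 \<in> H" "\<lbrakk>x \<in> H; y \<in> H\<rbrakk> \<Longrightarrow> x + y \<in> H" "\<lbrakk>x \<in> H; y \<in> H\<rbrakk> \<Longrightarrow> x - y \<in> H"
  "x \<in> H \<Longrightarrow> scale c x \<in> H"
  using subspace_H by (auto intro: subspace_0 subspace_add subspace_diff subspace_scale)

lemma add_right: "\<lbrakk>x \<in> H; y \<in> H; z \<in> H\<rbrakk> \<Longrightarrow> g z (x + y) = g z x + g z y"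
  by (metis H_closed(2) complex_cnj_add add_left commute)

lemma scale_right: "\<lbrakk>x \<in> H; y \<in> H\<rbrakk> \<Longrightarrow> g y (scale c x) = cnj c * g y x"
  by (metis H_closed(4) complex_cnj_mult commute scale_left)

lemma diff_left: "\<lbrakk>x \<in> H; y \<in> H; z \<in> H\<rbrakk> \<Longrightarrow> g (x - y) z = g x z - g y z"
  using add_left[of "x - y" y z] by (simp add: H_closed)

lemma diff_right: "\<lbrakk>x \<in> H; y \<in> H; z \<in> H\<rbrakk> \<Longrightarrow> g z (x - y) = g z x - g z y"
  using add_right[of "x - y" y z] by (simp add: H_closed)

lemma self_ge_0: "x \<in> H \<Longrightarrow> Re (g x x) \<ge> 0"
  using ge_zero[of x] by (auto simp: nonneg_Reals_def)

lemma snorm_ge_0: "x \<in> H \<Longrightarrow> snorm x \<ge> 0"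
  by (simp add: snorm_def self_ge_0)

lemma self_eq: "x \<in> H \<Longrightarrow> g x x = (of_real (snorm x))\<^sup>2"
  using ge_zero[of x] by (auto simp: nonneg_Reals_def snorm_def simp flip: of_real_power)

lemma snorm_scale: "x \<in> H \<Longrightarrow> snorm (scale c x) = cmod c * snorm x"
proof -
  assume x: "x \<in> H"
  have "g (scale c x) (scale c x) = (c * cnj c) * g x x"
    using x by (simp add: H_closed scale_left scale_right)
  also have "\<dots> = of_real ((cmod c * snorm x)\<^sup>2)"
    using x self_eq[OF x] complex_norm_square[of c] by (simp add: power_mult_distrib)
  finally show ?thesis
    using snorm_ge_0[OF x] unfolding snorm_def[of "scale c x"] by simp
qed

text \<open>Positivity of the form at \<open>x - t \<langle>x | y\<rangle> y\<close> gives a quadratic inequality in the real number \<open>t\<close>.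
  If \<open>y\<close> has seminorm \<open>0\<close>, its quadratic term vanishes, and large \<open>t\<close> force \<open>\<langle>x | y\<rangle> = 0\<close>.\<close>

lemma cauchy_schwarz:
  assumes x: "x \<in> H" and y: "y \<in> H"
  shows "cmod (g x y) \<le> snorm x * snorm y"
proof -
  define a b c where "a = (snorm x)\<^sup>2" and "b = g x y" and "c = (snorm y)\<^sup>2"
  have pos: "0 \<le> a - 2 * t * (cmod b)\<^sup>2 + t\<^sup>2 * (cmod b)\<^sup>2 * c" for t :: real
  proof -
    define k where "k = - of_real t * b"
    have "g (x + scale k y) (x + scale k y)
        = of_real a + cnj k * b + k * cnj b + k * cnj k * of_real c"
      using x y by (simp add: H_closed add_left add_right scale_left scale_right
          commute[OF x y] self_eq[OF x] self_eq[OF y] a_def b_def c_def algebra_simps)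
    also have "\<dots> = of_real a - 2 * of_real t * (b * cnj b) + of_real (t\<^sup>2) * (b * cnj b) * of_real c"
      by (simp add: k_def algebra_simps power2_eq_square)
    also have "\<dots> = of_real (a - 2 * t * (cmod b)\<^sup>2 + t\<^sup>2 * (cmod b)\<^sup>2 * c)"
      using complex_norm_square[of b] by simp
    finally show ?thesis
      using self_ge_0[of "x + scale k y"] x y by (simp add: H_closed)
  qed
  have "(cmod b)\<^sup>2 \<le> a * c"
  proof (cases "c = 0")
    case True
    have "b = 0"
    proof (rule ccontr)
      assume "b \<noteq> 0"
      then show False
        using pos[of "(a + 1) / (2 * (cmod b)\<^sup>2)"] True by simp
    qed
    then show ?thesis using True by simp
  next
    case False
    then have "c > 0" by (simp add: c_def)
    then show ?thesis
      using pos[of "1 / c"] by (simp add: field_simps power2_eq_square)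
  qed
  then have "(cmod b)\<^sup>2 \<le> (snorm x * snorm y)\<^sup>2"
    by (simp add: a_def c_def power_mult_distrib)
  then show ?thesis
    unfolding b_def by (rule power2_le_imp_le) (simp add: x y snorm_ge_0)
qed

lemma snorm_triangle:
  assumes x: "x \<in> H" and y: "y \<in> H"
  shows "snorm (x + y) \<le> snorm x + snorm y"
proof (rule power2_le_imp_le)
  have "of_real ((snorm (x + y))\<^sup>2) = of_real ((snorm x)\<^sup>2) + of_real ((snorm y)\<^sup>2) + (g x y + cnj (g x y))"
    using x y by (simp add: self_eq[symmetric] H_closed add_left add_right commute[OF x y])
  then have "(snorm (x + y))\<^sup>2 = (snorm x)\<^sup>2 + (snorm y)\<^sup>2 + 2 * Re (g x y)"
    by (auto dest: arg_cong[of _ _ Re])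
  moreover have "Re (g x y) \<le> snorm x * snorm y"
    using cauchy_schwarz[OF x y] complex_Re_le_cmod order_trans by blast
  ultimately show "(snorm (x + y))\<^sup>2 \<le> (snorm x + snorm y)\<^sup>2"
    by (simp add: power2_sum)
  show "0 \<le> snorm x + snorm y"
    using x y by (simp add: snorm_ge_0)
qed

lemma snorm_diff_le:
  assumes x: "x \<in> H" and y: "y \<in> H"
  shows "snorm (x - y) \<le> snorm x + snorm y"
  using snorm_triangle[OF x H_closed(4)[OF y], of "-1"] snorm_scale[OF y, of "-1"] by simp

section \<open>Adjoint pairs and the two inequalities\<close>

lemma adjoint_pairD:
  assumes "adjoint_pair T S" "x \<in> H"
  shows "T x \<in> H" "S x \<in> H" "y \<in> H \<Longrightarrow> g (T x) y = g x (S y)" "y \<in> H \<Longrightarrow> g (S x) y = g x (T y)"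
proof -
  show 1: "T x \<in> H" "S x \<in> H" "y \<in> H \<Longrightarrow> g (T x) y = g x (S y)"
    using assms by (auto simp: adjoint_pair_def)
  show "g (S x) y = g x (T y)" if "y \<in> H"
  proof -
    have "T y \<in> H" "S x \<in> H" "g (T y) x = g y (S x)"
      using assms that by (auto simp: adjoint_pair_def)
    then show ?thesis
      using commute[of "T y" x] commute[of y "S x"] assms(2) that by simp
  qed
qed

text \<open>Polarization turns a bound on \<open>\<langle>Bx | x\<rangle>\<close> into a bound on \<open>Re \<langle>Bx | y\<rangle>\<close> by the parallelogram law. Taking
  \<open>y = Bx / w\<close> makes the left-hand side a multiple of \<open>\<parallel>Bx\<parallel>\<^sup>2\<close> and balances the two terms on the right.
  The vector \<open>x\<close> may have seminorm \<open>0\<close>; so the lemma also says that \<open>B\<close> preserves null vectors.\<close>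

lemma symmetric_bound_of_form_bound:
  assumes B: "adjoint_pair B B" and w: "w \<ge> 0"
    and form: "\<And>x. x \<in> H \<Longrightarrow> cmod (g (B x) x) \<le> w * (snorm x)\<^sup>2"
    and x: "x \<in> H"
  shows "snorm (B x) \<le> w * snorm x"
proof -
  note D = adjoint_pairD[OF B]
  have polar: "4 * Re (g (B x) y) \<le> 2 * w * ((snorm x)\<^sup>2 + (snorm y)\<^sup>2)" if y: "y \<in> H" for y
  proof -
    have 1: "g (B (x + y)) (x + y) - g (B (x - y)) (x - y) = 2 * (g (B x) y + g (B y) x)"
      using x y by (simp add: D H_closed add_left add_right diff_left diff_right)
    have 2: "g (B y) x = cnj (g (B x) y)"
      using x y by (simp add: D commute[of _ y])
    have 3: "complex_of_real ((snorm (x + y))\<^sup>2 + (snorm (x - y))\<^sup>2)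
        = of_real (2 * ((snorm x)\<^sup>2 + (snorm y)\<^sup>2))"
      using x y by (simp add: self_eq[symmetric] H_closed add_left add_right diff_left diff_right
         )
    have "4 * Re (g (B x) y) = Re (g (B (x + y)) (x + y)) - Re (g (B (x - y)) (x - y))"
      using arg_cong[OF 1, of Re] 2 by simp
    also have "\<dots> \<le> w * (snorm (x + y))\<^sup>2 + w * (snorm (x - y))\<^sup>2"
      using form[of "x + y"] form[of "x - y"] x y
        abs_Re_le_cmod[of "g (B (x + y)) (x + y)"] abs_Re_le_cmod[of "g (B (x - y)) (x - y)"]
      by (simp add: H_closed)
    also have "\<dots> = w * (2 * ((snorm x)\<^sup>2 + (snorm y)\<^sup>2))"
      using 3 unfolding of_real_eq_iff by (metis distrib_left)
    finally show ?thesis by (simp only: mult.assoc mult.left_commute)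
  qed
  (* y = t B x with real t; the choice t = 1 / w is optimal *)
  have t: "2 * t * (snorm (B x))\<^sup>2 \<le> w * ((snorm x)\<^sup>2 + t\<^sup>2 * (snorm (B x))\<^sup>2)" for t :: real
    using polar[of "scale (of_real t) (B x)"] x
    by (simp add: D H_closed scale_right self_eq snorm_scale power_mult_distrib)
  have "(snorm (B x))\<^sup>2 \<le> (w * snorm x)\<^sup>2"
  proof (cases "w = 0")
    case True
    then show ?thesis using t[of 1] by simp
  next
    case False
    then have "w > 0" using w by simp
    then show ?thesis
      using t[of "1 / w"] by (simp add: field_simps power2_eq_square)
  qed
  then show ?thesis
    by (rule power2_le_imp_le) (simp add: w x snorm_ge_0)
qed

text \<open>With \<open>a n = \<parallel>B\<^sup>n x\<parallel>\<close>, symmetry and Cauchy--Schwarz give \<open>(a (n+1))\<^sup>2 = \<langle>B\<^sup>n x | B\<^sup>n\<^sup>+\<^sup>2 x\<rangle> \<le> a n * a (n+2)\<close>. So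
  the quotients \<open>a (n+1) / a n\<close> increase, and \<open>a n\<close> grows at least like the powers of \<open>a 1 / a 0\<close>. The
  factor \<open>C\<close> may depend on \<open>x\<close>, and it disappears from the conclusion; this is what makes it possible
  to pass from a bound for a larger norm to a bound for the seminorm.\<close>

lemma symmetric_bound_of_growth:
  assumes B: "adjoint_pair B B" and x: "x \<in> H"
    and K: "K > 0" and growth: "\<And>n. snorm ((B ^^ n) x) \<le> C * K ^ n"
  shows "snorm (B x) \<le> K * snorm x"
proof -
  note D = adjoint_pairD[OF B]
  define a where "a n = snorm ((B ^^ n) x)" for n
  have mem: "(B ^^ n) x \<in> H" for n
    by (induction n) (simp_all add: x D)
  have a0: "a n \<ge> 0" for n
    by (simp add: a_def snorm_ge_0 mem)
  have convex: "(a (Suc n))\<^sup>2 \<le> a n * a (Suc (Suc n))" for n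
  proof -
    have "of_real ((a (Suc n))\<^sup>2) = g ((B ^^ n) x) ((B ^^ Suc (Suc n)) x)"
      using mem[of n] mem[of "Suc n"] by (simp add: a_def self_eq[symmetric] D)
    then have "(a (Suc n))\<^sup>2 = cmod (g ((B ^^ n) x) ((B ^^ Suc (Suc n)) x))"
      by (metis norm_of_real abs_power2)
    then show ?thesis
      using cauchy_schwarz[OF mem[of n] mem[of "Suc (Suc n)"]] by (simp only: a_def)
  qed
  (* the quotients a (n+1) / a n are at least a 1 / a 0; stated without division since a n may be 0 *)
  have step: "a 1 * a n \<le> a 0 * a (Suc n)" for n
  proof (induction n)
    case (Suc n)
    show ?case
    proof (cases "a n = 0")
      case True
      then have "a (Suc n) = 0" using convex[of n] by simp
      then show ?thesis using a0 by simp
    next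
      case False
      then have pos: "a n > 0" using a0[of n] by simp
      have "a n * (a 1 * a (Suc n)) \<le> a 0 * (a (Suc n))\<^sup>2"
        using mult_right_mono[OF Suc.IH a0[of "Suc n"]] by (simp add: power2_eq_square algebra_simps)
      also have "\<dots> \<le> a 0 * (a n * a (Suc (Suc n)))"
        using convex a0 by (simp add: mult_left_mono)
      finally show ?thesis using pos by (simp add: algebra_simps)
    qed
  qed simp
  have "a 1 \<le> K * a 0"
  proof (cases "a 0 = 0")
    case True
    then show ?thesis using convex[of 0] step[of 1] a0[of 1] by (simp add: mult_le_0_iff)
  next
    case False
    then have pos: "a 0 > 0" using a0[of 0] by simp
    (* if q > 1, then q ^ n is unbounded, against the growth assumption *)
    define q where "q = a 1 / (K * a 0)"
    have qn: "a 0 * q ^ n * K ^ n \<le> a n" for n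
    proof (induction n)
      case (Suc n)
      have "a 0 * q ^ Suc n * K ^ Suc n = (a 0 * q ^ n * K ^ n) * (a 1 / a 0)"
        using K by (simp add: q_def)
      also have "\<dots> \<le> a n * (a 1 / a 0)"
        by (rule mult_right_mono[OF Suc.IH]) (simp add: a0)
      also have "\<dots> \<le> a (Suc n)"
        using step[of n] pos by (simp add: field_simps)
      finally show ?case .
    qed simp
    have bound: "q ^ n \<le> C / a 0" for n
    proof -
      have "a 0 * q ^ n * K ^ n \<le> C * K ^ n"
        using order_trans[OF qn growth[of n, folded a_def]] .
      then show ?thesis using K pos by (simp add: field_simps)
    qed
    have "q \<le> 1"
    proof (rule ccontr)
      assume "\<not> q \<le> 1"
      then obtain n where "C / a 0 < q ^ n"
        using real_arch_pow[of q "C / a 0"] by auto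
      then show False using bound[of n] by simp
    qed
    then show ?thesis
      using K pos by (simp add: q_def field_simps)
  qed
  then show ?thesis by (simp add: a_def)
qed

lemma snorm_sq_sum_eq_form:
  assumes TS: "adjoint_pair T S" and x: "x \<in> H"
  shows "of_real ((snorm (T x))\<^sup>2 + (snorm (S x))\<^sup>2) = g (S (T x) + T (S x)) x"
  using adjoint_pairD[OF TS] x
  by (simp add: add_left self_eq[symmetric] H_closed)

lemma form_sq_le_anticomm:
  assumes TS: "adjoint_pair T S" and x: "x \<in> H" "snorm x = 1"
  shows "(cmod (g (T x) x))\<^sup>2 \<le> 1/2 * snorm (S (T x) + T (S x))"
proof -
  note D = adjoint_pairD[OF TS]
  have 1: "cmod (g (T x) x) \<le> snorm (T x)"
    using cauchy_schwarz[of "T x" x] D x by simp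
  have 2: "cmod (g (T x) x) \<le> snorm (S x)"
    using cauchy_schwarz[of x "S x"] D x by simp
  have "2 * (cmod (g (T x) x))\<^sup>2 \<le> (snorm (T x))\<^sup>2 + (snorm (S x))\<^sup>2"
    using power_mono[OF 1, of 2] power_mono[OF 2, of 2] by simp
  also have "\<dots> = cmod (g (S (T x) + T (S x)) x)"
    using snorm_sq_sum_eq_form[OF TS x(1)] by (metis norm_of_real abs_of_nonneg add_nonneg_nonneg zero_le_power2)
  also have "\<dots> \<le> snorm (S (T x) + T (S x))"
    using cauchy_schwarz[of "S (T x) + T (S x)" x] D x by (simp add: H_closed)
  finally show ?thesis by simp
qed

text \<open>With \<open>B = T + S\<close> and \<open>E = T - S\<close> the mixed terms cancel in \<open>B\<^sup>2 - E\<^sup>2 = 2(ST + TS)\<close>. Each of \<open>B\<close> and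
  \<open>iE\<close> is symmetric with quadratic form at most \<open>2w\<close>.\<close>

lemma anticomm_le_form_sq:
  assumes TS: "adjoint_pair T S"
    and add: "\<And>x y. \<lbrakk>x \<in> H; y \<in> H\<rbrakk> \<Longrightarrow> T (x + y) = T x + T y"
      "\<And>x y. \<lbrakk>x \<in> H; y \<in> H\<rbrakk> \<Longrightarrow> S (x + y) = S x + S y"
    and w: "w \<ge> 0" and form: "\<And>x. x \<in> H \<Longrightarrow> cmod (g (T x) x) \<le> w * (snorm x)\<^sup>2"
    and x: "x \<in> H"
  shows "1/4 * snorm (S (T x) + T (S x)) \<le> w\<^sup>2 * snorm x"
proof -
  note D = adjoint_pairD[OF TS]
  have diff: "T (y - z) = T y - T z" "S (y - z) = S y - S z" if "y \<in> H" "z \<in> H" for y z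
    using that add(1)[of "y - z" z] add(2)[of "y - z" z] by (simp_all add: H_closed)
  define B where "B y = T y + S y" for y
  define E where "E y = T y - S y" for y
  have H: "B y \<in> H" "E y \<in> H" if "y \<in> H" for y
    using that D by (simp_all add: B_def E_def H_closed)
  have form': "cmod (g (S y) y) \<le> w * (snorm y)\<^sup>2" if "y \<in> H" for y
    using form[OF that] that D commute[of "T y" y] by (metis complex_mod_cnj)
  have B: "snorm (B y) \<le> 2 * w * snorm y" if y: "y \<in> H" for y
  proof (rule symmetric_bound_of_form_bound[OF _ _ _ y])
    show "adjoint_pair B B"
      using D H by (auto simp: adjoint_pair_def B_def add_left add_right)
    show "cmod (g (B z) z) \<le> 2 * w * (snorm z)\<^sup>2" if "z \<in> H" for z
      using form[OF that] form'[OF that] D that norm_triangle_ineq[of "g (T z) z" "g (S z) z"]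
      by (simp add: B_def add_left)
  qed (use w in simp)
  have E: "snorm (E y) \<le> 2 * w * snorm y" if y: "y \<in> H" for y
  proof -
    have "snorm (scale \<i> (E y)) \<le> 2 * w * snorm y"
    proof (rule symmetric_bound_of_form_bound[OF _ _ _ y])
      show "adjoint_pair (\<lambda>y. scale \<i> (E y)) (\<lambda>y. scale \<i> (E y))"
        using D H unfolding adjoint_pair_def
        by (auto simp: scale_left scale_right H_closed) (simp add: E_def diff_left diff_right algebra_simps)
      show "cmod (g (scale \<i> (E z)) z) \<le> 2 * w * (snorm z)\<^sup>2" if "z \<in> H" for z
        using form[OF that] form'[OF that] D H that norm_triangle_ineq4[of "g (T z) z" "g (S z) z"]
        by (simp add: scale_left norm_mult) (simp add: E_def diff_left)
    qed (use w in simp)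
    then show ?thesis using H y by (simp add: snorm_scale)
  qed
  have "B (B x) - E (E x) = scale 2 (S (T x) + T (S x))"
    using D x by (simp add: B_def E_def add diff H_closed scale_left_distrib[of 1 1, simplified])
  then have "2 * snorm (S (T x) + T (S x)) = snorm (B (B x) - E (E x))"
    using D x by (simp add: snorm_scale H_closed)
  also have "\<dots> \<le> snorm (B (B x)) + snorm (E (E x))"
    using H x by (simp add: snorm_diff_le)
  also have "\<dots> \<le> 2 * w * (2 * w * snorm x) + 2 * w * (2 * w * snorm x)"
    using B[OF H(1)[OF x]] E[OF H(2)[OF x]]
      mult_left_mono[OF B[OF x], of "2 * w"] mult_left_mono[OF E[OF x], of "2 * w"] w by simp
  finally show ?thesis by (simp add: power2_eq_square)
qed

end

section \<open>Riesz representation and adjoints\<close>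

lemma (in complex_inner_space) semi_inner_space: "complex_semi_inner_space scale H ip"
  by unfold_locales (fact subspace_H ip_add_left ip_scale_left ip_commute ip_ge_zero)+

sublocale complex_inner_space \<subseteq> semi: complex_semi_inner_space scale H ip
  rewrites "complex_semi_inner_space.snorm ip = hnorm"
proof -
  show "complex_semi_inner_space scale H ip"
    by (rule semi_inner_space)
  then show "complex_semi_inner_space.snorm ip = hnorm"
    by (simp add: fun_eq_iff complex_semi_inner_space.snorm_def hnorm_def)
qed

context complex_inner_space
begin

text \<open>Typical use: the vectors of a subspace \<open>M\<close> are determined by their inner products with \<open>M\<close>.\<close>

lemma ip_eqI:
  assumes "x \<in> H" "y \<in> H" "\<And>u. u \<in> M \<Longrightarrow> ip u x = ip u y" "x - y \<in> M"
  shows "x = y"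
proof -
  have "ip (x - y) (x - y) = 0"
    using assms by (simp add: semi.diff_right H_closed)
  then show ?thesis
    using ip_eq_zero[of "x - y"] assms by (simp add: H_closed)
qed

lemma orthogonal_closure:
  assumes S: "S \<subseteq> H" and x: "x \<in> hmet.mtopology closure_of S"
    and w: "w \<in> H" "\<And>s. s \<in> S \<Longrightarrow> ip s w = 0"
  shows "ip x w = 0"
proof (rule ccontr)
  assume "ip x w \<noteq> 0"
  then have pos: "cmod (ip x w) / (hnorm w + 1) > 0"
    using semi.snorm_ge_0[OF w(1)] by simp
  obtain s where s: "x \<in> H" "s \<in> S" "s \<in> H" "hdist x s < cmod (ip x w) / (hnorm w + 1)"
    using x pos unfolding hmet.metric_closure_of by auto
  have "ip x w = ip (x - s) w"
    using s w by (simp add: semi.diff_left)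
  then have "cmod (ip x w) \<le> hnorm (x - s) * hnorm w"
    using cauchy_schwarz[of "x - s" w] s w by (simp add: H_closed)
  also have "\<dots> \<le> hdist x s * (hnorm w + 1)"
    using s semi.snorm_ge_0[of "x - s"] by (simp add: hdist_def H_closed mult_left_mono)
  also have "\<dots> < cmod (ip x w)"
    using s semi.snorm_ge_0[OF w(1)] by (simp add: field_simps)
  finally show False by simp
qed

lemma subspace_closure:
  assumes M: "M \<subseteq> H" "subspace M"
  shows "subspace (hmet.mtopology closure_of M)"
proof (rule subspaceI)
  have approx: "\<exists>u\<in>M. hnorm (x - u) < r"
    if "x \<in> hmet.mtopology closure_of M" "r > 0" for x r
    using that M by (fastforce simp: hmet.metric_closure_of hdist_def)
  have inH: "x \<in> H" if "x \<in> hmet.mtopology closure_of M" for x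
    using that unfolding hmet.metric_closure_of by simp
  have memI: "x \<in> hmet.mtopology closure_of M"
    if "x \<in> H" "\<And>r. r > 0 \<Longrightarrow> \<exists>u\<in>M. hnorm (x - u) < r" for x
    using that M by (fastforce simp: hmet.metric_closure_of hdist_def)
  show "0 \<in> hmet.mtopology closure_of M"
    using closure_of_subset[of M hmet.mtopology] M subspace_0 by auto
  show "x + y \<in> hmet.mtopology closure_of M"
    if x: "x \<in> hmet.mtopology closure_of M" and y: "y \<in> hmet.mtopology closure_of M" for x y
  proof (rule memI)
    fix r :: real assume "r > 0"
    then obtain u v where uv: "u \<in> M" "hnorm (x - u) < r / 2" "v \<in> M" "hnorm (y - v) < r / 2"
      using approx[OF x, of "r / 2"] approx[OF y, of "r / 2"] by auto
    have "hnorm ((x - u) + (y - v)) \<le> hnorm (x - u) + hnorm (y - v)"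
      using uv M inH[OF x] inH[OF y] by (intro hnorm_triangle) (auto simp: H_closed)
    also have "(x - u) + (y - v) = x + y - (u + v)"
      by simp
    finally show "\<exists>w\<in>M. hnorm (x + y - w) < r"
      using uv subspace_add[OF M(2) uv(1,3)] by (intro bexI[of _ "u + v"]) auto
  qed (use inH x y in \<open>simp add: H_closed\<close>)
  show "scale c x \<in> hmet.mtopology closure_of M"
    if x: "x \<in> hmet.mtopology closure_of M" for c x
  proof (rule memI)
    fix r :: real assume r: "r > 0"
    have c: "cmod c + 1 > 0" by (rule add_nonneg_pos) auto
    obtain u where u: "u \<in> M" "hnorm (x - u) < r / (cmod c + 1)"
      using approx[OF x divide_pos_pos[OF r c]] by auto
    have uH: "x - u \<in> H" using u M inH[OF x] by (auto simp: H_closed)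
    have "hnorm (scale c x - scale c u) = cmod c * hnorm (x - u)"
      using semi.snorm_scale[OF uH, of c] by (simp add: scale_right_diff_distrib)
    also have "\<dots> \<le> (cmod c + 1) * hnorm (x - u)"
      using semi.snorm_ge_0[OF uH] by (simp add: mult_right_mono)
    also have "\<dots> < r"
      using u c by (simp add: field_simps)
    finally show "\<exists>w\<in>M. hnorm (scale c x - w) < r"
      using subspace_scale[OF M(2) u(1)] by blast
  qed (use inH x in \<open>simp add: H_closed\<close>)
qed

end

context complex_hilbert_space
begin

text \<open>The representing vector minimizes \<open>J m = \<parallel>m\<parallel>\<^sup>2 - 2 Re f(m)\<close> over \<open>M\<close>. Since \<open>J\<close> is quadratic with leading
  part \<open>\<parallel>m\<parallel>\<^sup>2\<close>, comparing two almost minimizing vectors with their midpoint shows that they are close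
  to each other, so a minimizing sequence converges. Varying an almost minimizing vector \<open>u\<close> in the
  direction \<open>m\<close> shows that \<open>f(m) - \<langle>m | u\<rangle>\<close> is small.\<close>

lemma riesz_on_closed_subspace:
  assumes M: "M \<subseteq> H" "subspace M" "closedin hmet.mtopology M"
    and add: "\<And>x y. \<lbrakk>x \<in> M; y \<in> M\<rbrakk> \<Longrightarrow> f (x + y) = f x + f y"
    and hom: "\<And>c x. x \<in> M \<Longrightarrow> f (scale c x) = c * f x"
    and bound: "\<And>x. x \<in> M \<Longrightarrow> cmod (f x) \<le> K * hnorm x"
  shows "\<exists>z\<in>M. \<forall>m\<in>M. f m = ip m z"
proof -
  define J where "J m = (hnorm m)\<^sup>2 - 2 * Re (f m)" for m
  have MH: "x \<in> H" if "x \<in> M" for x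
    using M that by auto
  have J_ge: "- K\<^sup>2 \<le> J m" if m: "m \<in> M" for m
  proof -
    have "Re (f m) \<le> K * hnorm m"
      using bound[OF m] complex_Re_le_cmod order_trans by blast
    moreover have "0 \<le> (hnorm m - K)\<^sup>2" by simp
    ultimately show ?thesis by (simp add: J_def power2_diff algebra_simps)
  qed
  have J_perturb: "J (u + scale k m) = J u - 2 * Re (k * (f m - ip m u)) + (cmod k)\<^sup>2 * (hnorm m)\<^sup>2"
    if u: "u \<in> M" and m: "m \<in> M" for u m k
  proof -
    have "complex_of_real ((hnorm (u + scale k m))\<^sup>2)
        = of_real ((hnorm u)\<^sup>2) + (k * ip m u + cnj (k * ip m u)) + (k * cnj k) * of_real ((hnorm m)\<^sup>2)"
      using MH[OF u] MH[OF m]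
      by (simp add: semi.self_eq[symmetric] H_closed ip_add_left ip_add_right ip_scale_left
          ip_scale_right ip_commute[of m u] algebra_simps)
    also have "k * cnj k = of_real ((cmod k)\<^sup>2)"
      using complex_norm_square[of k] by simp
    finally have "(hnorm (u + scale k m))\<^sup>2
        = (hnorm u)\<^sup>2 + 2 * Re (k * ip m u) + (cmod k)\<^sup>2 * (hnorm m)\<^sup>2"
      by (auto dest: arg_cong[of _ _ Re] simp flip: of_real_mult of_real_power)
    moreover have "f (u + scale k m) = f u + k * f m"
      using u m subspace_scale[OF M(2)] by (simp add: add hom)
    ultimately show ?thesis
      by (simp add: J_def algebra_simps)
  qed
  (* u is a minimizing sequence with error at most e n *)
  define i where "i = Inf (J ` M)"
  have bdd: "bdd_below (J ` M)"
    using J_ge by (intro bdd_belowI[of _ "- K\<^sup>2"]) auto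
  have ne: "J ` M \<noteq> {}"
    using subspace_0[OF M(2)] by auto
  have i_le: "i \<le> J m" if "m \<in> M" for m
    unfolding i_def using bdd that by (simp add: cInf_lower)
  define e where "e n = 1 / (real n + 1)" for n
  have "\<exists>m\<in>M. J m < i + e n" for n
    using cInf_lessD[OF ne, of "i + e n"] by (auto simp: i_def e_def)
  then obtain u where u: "\<And>n. u n \<in> M" "\<And>n. J (u n) < i + e n"
    by metis
  have gap: "(hnorm (u j - u k))\<^sup>2 \<le> 2 * e j + 2 * e k" for j k
  proof -
    define m where "m = u j - u k"
    have m: "m \<in> M" using u subspace_diff[OF M(2)] by (simp add: m_def)
    have half: "u k + scale (1/2) m \<in> M"
      using u m subspace_add[OF M(2)] subspace_scale[OF M(2)] by simp
    have "i \<le> J (u k) - Re (f m - ip m (u k)) + (hnorm m)\<^sup>2 / 4"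
      using i_le[OF half] J_perturb[OF u(1) m, of k "1/2"] by (simp add: power2_eq_square norm_divide field_simps)
    moreover have "J (u j) = J (u k) - 2 * Re (f m - ip m (u k)) + (hnorm m)\<^sup>2"
      using J_perturb[OF u(1) m, of k 1] by (simp add: m_def)
    ultimately show ?thesis
      using u(2)[of j] u(2)[of k] by (simp add: m_def)
  qed
  have e_small: "\<exists>N. \<forall>n\<ge>N. e n < r" if r: "r > 0" for r
  proof -
    obtain N where "1 / real (Suc N) < r"
      using nat_approx_posE[OF r] by blast
    moreover have "e n \<le> 1 / real (Suc N)" if "n \<ge> N" for n
      using that by (simp add: e_def frac_le)
    ultimately show ?thesis by (meson order_le_less_trans)
  qed
  have "hmet.MCauchy u"
    unfolding hmet.MCauchy_def
  proof (intro conjI allI impI)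
    show "range u \<subseteq> H" using u MH by auto
    fix r :: real assume r: "r > 0"
    then obtain N where N: "\<And>n. n \<ge> N \<Longrightarrow> e n < r\<^sup>2 / 4"
      using e_small[of "r\<^sup>2 / 4"] by auto
    have "hdist (u j) (u k) < r" if "N \<le> j" "N \<le> k" for j k
    proof -
      have "(hnorm (u j - u k))\<^sup>2 < r\<^sup>2"
        using gap[of j k] N[OF that(1)] N[OF that(2)] by simp
      then show ?thesis
        using r u MH by (simp add: hdist_def power2_less_imp_less)
    qed
    then show "\<exists>N. \<forall>j k. N \<le> j \<longrightarrow> N \<le> k \<longrightarrow> hdist (u j) (u k) < r"
      by blast
  qed
  then obtain z where z: "limitin hmet.mtopology u z sequentially"
    using complete unfolding hmet.mcomplete_def by blast
  have zM: "z \<in> M"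
    using limitin_closedin[OF z M(3)] u by simp
  have near: "(cmod (f m - ip m (u n)))\<^sup>2 \<le> ((hnorm m)\<^sup>2 + 1) * e n" if m: "m \<in> M" for m n
  proof -
    define d where "d = f m - ip m (u n)"
    (* the step t * cnj d decreases J by at least t * |d|^2; adding 1 to |m|^2 covers m = 0 *)
    define q where "q = (hnorm m)\<^sup>2 + 1"
    have q: "q > 0" by (simp add: q_def add_nonneg_pos)
    define t where "t = 1 / q"
    have "J (u n) - e n < J (u n + scale (of_real t * cnj d) m)"
      using u(2)[of n] i_le[of "u n + scale (of_real t * cnj d) m"]
        subspace_add[OF M(2) u(1) subspace_scale[OF M(2) m]] by force
    also have "\<dots> = J (u n) - 2 * (t * (cmod d)\<^sup>2) + (t * cmod d)\<^sup>2 * (hnorm m)\<^sup>2"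
    proof -
      have "of_real t * cnj d * d = of_real (t * (cmod d)\<^sup>2)"
        using complex_norm_square[of d] by (simp add: mult.assoc mult.commute)
      then show ?thesis
        using J_perturb[OF u(1) m, of n "of_real t * cnj d"] q
        by (simp add: d_def[symmetric] norm_mult norm_divide t_def)
    qed
    also have "(t * cmod d)\<^sup>2 * (hnorm m)\<^sup>2 \<le> (t * cmod d)\<^sup>2 * q"
      by (rule mult_left_mono) (simp_all add: q_def)
    also have "(t * cmod d)\<^sup>2 * q = t * (cmod d)\<^sup>2"
      using q by (simp add: t_def power2_eq_square)
    finally have "t * (cmod d)\<^sup>2 \<le> e n" by simp
    then show ?thesis
      using q by (simp add: t_def d_def q_def field_simps)
  qed
  have "f m = ip m z" if m: "m \<in> M" for m
  proof (rule ccontr)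
    assume "f m \<noteq> ip m z"
    define s where "s = cmod (f m - ip m z)"
    define q where "q = (hnorm m)\<^sup>2 + 1"
    have s: "s > 0" using \<open>f m \<noteq> ip m z\<close> by (simp add: s_def)
    have q: "q > 0" by (simp add: q_def add_nonneg_pos)
    have nm: "hnorm m < q"
    proof -
      have "0 \<le> (hnorm m - 1 / 2)\<^sup>2" by simp
      then show ?thesis by (simp add: q_def power2_eq_square algebra_simps)
    qed
    obtain N where N: "\<And>n. n \<ge> N \<Longrightarrow> e n < (s / 2)\<^sup>2 / q"
      using e_small[of "(s / 2)\<^sup>2 / q"] s q by auto
    obtain N' where N': "\<And>n. n \<ge> N' \<Longrightarrow> hdist (u n) z < s / (2 * q)"
      using z s q unfolding hmet.limit_metric_sequentially by (metis divide_pos_pos mult_pos_pos zero_less_numeral)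
    define n where "n = max N N'"
    have "(cmod (f m - ip m (u n)))\<^sup>2 < (s / 2)\<^sup>2"
      using near[OF m, of n] N[of n] q
      by (simp add: n_def q_def[symmetric] pos_less_divide_eq mult.commute del: power_divide)
    then have 1: "cmod (f m - ip m (u n)) < s / 2"
      by (rule power2_less_imp_less) (use s in simp)
    have "cmod (ip m (u n) - ip m z) = cmod (ip m (u n - z))"
      using MH m u zM by (simp add: semi.diff_right)
    also have "\<dots> \<le> hnorm m * hdist (u n) z"
      using cauchy_schwarz[of m "u n - z"] MH m u zM by (simp add: hdist_def H_closed)
    also have "\<dots> \<le> q * (s / (2 * q))"
      using nm N'[of n] q semi.snorm_ge_0[OF MH[OF m]] by (intro mult_mono) (auto simp: n_def)
    also have "\<dots> = s / 2" using q by simp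
    finally have "cmod (f m - ip m z) < s"
      using 1 norm_triangle_ineq[of "f m - ip m (u n)" "ip m (u n) - ip m z"] by simp
    then show False by (simp add: s_def)
  qed
  then show ?thesis using zM by blast
qed

lemma bounded_opD:
  assumes "T \<in> bounded_op" "x \<in> H"
  shows "T x \<in> H" "y \<in> H \<Longrightarrow> T (x + y) = T x + T y" "T (scale c x) = scale c (T x)"
  using assms by (auto simp: bounded_op_def)

lemma bounded_op_bound:
  assumes "T \<in> bounded_op"
  obtains K where "K > 0" "\<And>x. x \<in> H \<Longrightarrow> hnorm (T x) \<le> K * hnorm x"
proof -
  obtain K where K: "\<And>x. x \<in> H \<Longrightarrow> hnorm (T x) \<le> K * hnorm x"
    using assms unfolding bounded_op_def by blast
  have "hnorm (T x) \<le> max K 1 * hnorm x" if "x \<in> H" for x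
    using K[OF that] mult_right_mono[of K "max K 1" "hnorm x"] semi.snorm_ge_0[OF that] by simp
  then show ?thesis
    using that[of "max K 1"] by simp
qed

lemma bounded_op_comp:
  assumes T: "T \<in> bounded_op" and S: "S \<in> bounded_op"
  shows "(\<lambda>x\<in>H. T (S x)) \<in> bounded_op"
proof -
  obtain K L where K: "K > 0" "\<And>x. x \<in> H \<Longrightarrow> hnorm (T x) \<le> K * hnorm x"
    and L: "\<And>x. x \<in> H \<Longrightarrow> hnorm (S x) \<le> L * hnorm x"
    using bounded_op_bound[OF T] bounded_op_bound[OF S] by metis
  have "hnorm (T (S x)) \<le> (K * L) * hnorm x" if "x \<in> H" for x
    using order_trans[OF K(2)[OF bounded_opD(1)[OF S that]] mult_left_mono[OF L[OF that], of K]] K(1)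
    by (simp add: mult.assoc)
  then have "\<exists>C. \<forall>x\<in>H. hnorm (T (S x)) \<le> C * hnorm x"
    by blast
  then show ?thesis
    using bounded_opD[OF T] bounded_opD[OF S] by (auto simp: bounded_op_def H_closed)
qed

lemma bounded_op_eqI:
  assumes "S \<in> bounded_op" "S' \<in> bounded_op" "\<And>x. x \<in> H \<Longrightarrow> S x = S' x"
  shows "S = S'"
  using assms by (auto simp: bounded_op_def intro: PiE_ext)

text \<open>The vector \<open>Sx\<close> represents the functional \<open>m \<mapsto> \<langle>Rm | x\<rangle>\<close> on \<open>M\<close>. It is the only such vector in \<open>M\<close>, which
  makes \<open>S\<close> linear. For \<open>M = H\<close> this is the adjoint of a bounded operator, and for the inclusion \<open>R\<close>
  of \<open>M\<close> it is the orthogonal projection onto \<open>M\<close>.\<close>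

lemma adjoint_from_closed_subspace:
  assumes M: "M \<subseteq> H" "subspace M" "closedin hmet.mtopology M"
    and R: "\<And>m. m \<in> M \<Longrightarrow> R m \<in> H"
    and add: "\<And>x y. \<lbrakk>x \<in> M; y \<in> M\<rbrakk> \<Longrightarrow> R (x + y) = R x + R y"
    and hom: "\<And>c x. x \<in> M \<Longrightarrow> R (scale c x) = scale c (R x)"
    and K: "K \<ge> 0" and bound: "\<And>x. x \<in> M \<Longrightarrow> hnorm (R x) \<le> K * hnorm x"
  shows "\<exists>S\<in>bounded_op. S ` H \<subseteq> M \<and> (\<forall>m\<in>M. \<forall>x\<in>H. ip m (S x) = ip (R m) x)"
proof -
  have MH: "x \<in> H" if "x \<in> M" for x
    using M that by auto
  have "\<exists>z\<in>M. \<forall>m\<in>M. ip (R m) x = ip m z" if x: "x \<in> H" for x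
  proof (rule riesz_on_closed_subspace[OF M, where K = "K * hnorm x"])
    show "cmod (ip (R m) x) \<le> K * hnorm x * hnorm m" if "m \<in> M" for m
      using cauchy_schwarz[OF R[OF that] x]
        mult_right_mono[OF bound[OF that] semi.snorm_ge_0[OF x]] by (simp add: mult_ac)
  qed (use x R add hom in \<open>simp_all add: ip_add_left ip_scale_left\<close>)
  then obtain F where F: "\<And>x. x \<in> H \<Longrightarrow> F x \<in> M" "\<And>x m. \<lbrakk>x \<in> H; m \<in> M\<rbrakk> \<Longrightarrow> ip m (F x) = ip (R m) x"
    by metis
  have FH: "F x \<in> H" if "x \<in> H" for x
    using F(1)[OF that] MH by simp
  have F_add: "F (x + y) = F x + F y" if xy: "x \<in> H" "y \<in> H" for x y
  proof (rule ip_eqI)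
    show "ip m (F (x + y)) = ip m (F x + F y)" if "m \<in> M" for m
      using that xy F FH R MH by (simp add: ip_add_right H_closed)
    show "F (x + y) - (F x + F y) \<in> M"
      using F xy subspace_diff[OF M(2)] subspace_add[OF M(2)] by (simp add: H_closed)
  qed (use xy FH in \<open>auto simp: H_closed\<close>)
  have F_scale: "F (scale c x) = scale c (F x)" if x: "x \<in> H" for c x
  proof (rule ip_eqI)
    show "ip m (F (scale c x)) = ip m (scale c (F x))" if "m \<in> M" for m
      using that x F FH R MH by (simp add: ip_scale_right H_closed)
    show "F (scale c x) - scale c (F x) \<in> M"
      using F x subspace_diff[OF M(2)] subspace_scale[OF M(2)] by (simp add: H_closed)
  qed (use x FH in \<open>auto simp: H_closed\<close>)
  have F_bound: "hnorm (F x) \<le> K * hnorm x" if x: "x \<in> H" for x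
  proof (cases "hnorm (F x) = 0")
    case True
    then show ?thesis using K semi.snorm_ge_0[OF x] by simp
  next
    case False
    then have pos: "hnorm (F x) > 0" using semi.snorm_ge_0[OF FH[OF x]] by simp
    have "complex_of_real ((hnorm (F x))\<^sup>2) = ip (R (F x)) x"
      using F[OF x] FH[OF x] by (simp add: semi.self_eq[symmetric])
    then have "(hnorm (F x))\<^sup>2 = cmod (ip (R (F x)) x)"
      by (metis norm_of_real abs_power2)
    also have "\<dots> \<le> hnorm (R (F x)) * hnorm x"
      using cauchy_schwarz[OF R[OF F(1)[OF x]] x] .
    also have "\<dots> \<le> K * hnorm (F x) * hnorm x"
      using bound[OF F(1)[OF x]] semi.snorm_ge_0[OF x] by (simp add: mult_right_mono)
    finally show ?thesis
      using pos by (simp add: power2_eq_square algebra_simps)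
  qed
  have "(\<lambda>x\<in>H. F x) \<in> bounded_op"
    using FH F_add F_scale by (auto simp: bounded_op_def H_closed intro!: exI[of _ K] F_bound)
  then show ?thesis
    using F by (intro bexI[of _ "\<lambda>x\<in>H. F x"]) auto
qed

lemma closedin_H: "closedin hmet.mtopology H"
  using closedin_topspace[of hmet.mtopology] by simp

lemma adjoint_op_eqI:
  assumes S: "S \<in> bounded_op" "\<And>x y. \<lbrakk>x \<in> H; y \<in> H\<rbrakk> \<Longrightarrow> ip (T x) y = ip x (S y)"
  shows "adjoint_op T = S"
  unfolding adjoint_op_def
proof (rule the_equality)
  show "S \<in> bounded_op \<and> (\<forall>x\<in>H. \<forall>y\<in>H. ip (T x) y = ip x (S y))"
    using S by blast
  show "S' = S" if S': "S' \<in> bounded_op \<and> (\<forall>x\<in>H. \<forall>y\<in>H. ip (T x) y = ip x (S' y))" for S'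
  proof (rule bounded_op_eqI)
    fix y assume y: "y \<in> H"
    have H: "S y \<in> H" "S' y \<in> H"
      using S S' y bounded_opD(1) by blast+
    show "S' y = S y"
      by (rule ip_eqI[where M = H]) (use H S S' y in \<open>auto simp: H_closed\<close>)
  qed (use S S' in auto)
qed

lemma adjoint_op:
  assumes T: "T \<in> bounded_op"
  shows "adjoint_op T \<in> bounded_op"
    and "\<lbrakk>x \<in> H; y \<in> H\<rbrakk> \<Longrightarrow> ip (T x) y = ip x (adjoint_op T y)"
proof -
  obtain K where K: "K > 0" "\<And>x. x \<in> H \<Longrightarrow> hnorm (T x) \<le> K * hnorm x"
    using bounded_op_bound[OF T] by metis
  have "\<exists>S\<in>bounded_op. S ` H \<subseteq> H \<and> (\<forall>m\<in>H. \<forall>x\<in>H. ip m (S x) = ip (T m) x)"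
    using bounded_opD[OF T] K
    by (intro adjoint_from_closed_subspace[where K = K]) (auto simp: subspace_H closedin_H)
  then obtain S where S: "S \<in> bounded_op" "\<And>x y. \<lbrakk>x \<in> H; y \<in> H\<rbrakk> \<Longrightarrow> ip (T x) y = ip x (S y)"
    by metis
  then have "adjoint_op T = S"
    by (rule adjoint_op_eqI)
  then show "adjoint_op T \<in> bounded_op"
    and "\<lbrakk>x \<in> H; y \<in> H\<rbrakk> \<Longrightarrow> ip (T x) y = ip x (adjoint_op T y)"
    using S by auto
qed

section \<open>The semi-inner product of a positive operator\<close>

lemma positive_opD: "A \<in> positive_op \<Longrightarrow> A \<in> bounded_op"
  by (simp add: positive_op_def)

text \<open>Over the complex numbers, a form that is real on the diagonal is hermitian: the values at \<open>x + y\<close>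
  and at \<open>x + iy\<close> determine the imaginary and the real part of \<open>\<langle>Ax | y\<rangle> - cnj \<langle>Ay | x\<rangle>\<close>.\<close>

lemma positive_op_symmetric:
  assumes A: "A \<in> positive_op" and x: "x \<in> H" and y: "y \<in> H"
  shows "ip (A x) y = ip x (A y)"
proof -
  note AD = bounded_opD[OF positive_opD[OF A]]
  have real: "Im (ip (A v) v) = 0" if "v \<in> H" for v
    using A that by (auto simp: positive_op_def nonneg_Reals_def)
  have "Im (ip (A (x + y)) (x + y)) = Im (ip (A x) y) + Im (ip (A y) x)"
    using x y AD real by (simp add: H_closed ip_add_left ip_add_right)
  moreover have "Im (ip (A (x + scale \<i> y)) (x + scale \<i> y)) = Re (ip (A y) x) - Re (ip (A x) y)"
    using x y AD real by (simp add: H_closed ip_add_left ip_add_right ip_scale_left ip_scale_right)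
  ultimately have "ip (A x) y = cnj (ip (A y) x)"
    using real x y by (simp add: complex_eq_iff H_closed)
  then show ?thesis
    using ip_commute[of "A y" x] AD x y by simp
qed

lemma semi_inner_space_A_ip:
  assumes A: "A \<in> positive_op"
  shows "complex_semi_inner_space scale H (A_ip A)"
proof
  note AD = bounded_opD[OF positive_opD[OF A]]
  show "A_ip A y x = cnj (A_ip A x y)" if "x \<in> H" "y \<in> H" for x y
    using that AD positive_op_symmetric[OF A] ip_commute[of "A x" y] by (simp add: A_ip_def)
  show "A_ip A x x \<in> \<real>\<^sub>\<ge>\<^sub>0" if "x \<in> H" for x
    using A that by (simp add: A_ip_def positive_op_def)
qed (use subspace_H bounded_opD[OF positive_opD[OF A]] in
    \<open>simp_all add: A_ip_def ip_add_left ip_scale_left\<close>)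

lemma A_norm_eq_snorm: "A_norm A = complex_semi_inner_space.snorm (A_ip A)" if "A \<in> positive_op"
  using semi_inner_space_A_ip[OF that]
  by (simp add: fun_eq_iff A_norm_def complex_semi_inner_space.snorm_def)

lemma A_norm_le_hnorm:
  assumes A: "A \<in> positive_op"
  obtains L where "L \<ge> 0" "\<And>x. x \<in> H \<Longrightarrow> A_norm A x \<le> L * hnorm x"
proof -
  obtain K where K: "K > 0" "\<And>x. x \<in> H \<Longrightarrow> hnorm (A x) \<le> K * hnorm x"
    using bounded_op_bound[OF positive_opD[OF A]] by metis
  have "A_norm A x \<le> sqrt K * hnorm x" if x: "x \<in> H" for x
  proof -
    have "Re (ip (A x) x) \<le> hnorm (A x) * hnorm x"
      using cauchy_schwarz[OF bounded_opD(1)[OF positive_opD[OF A] x] x] complex_Re_le_cmod order_trans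
      by blast
    also have "\<dots> \<le> K * hnorm x * hnorm x"
      using K(2)[OF x] semi.snorm_ge_0[OF x] by (simp add: mult_right_mono)
    finally have "A_norm A x \<le> sqrt (K * (hnorm x)\<^sup>2)"
      by (simp add: A_norm_def A_ip_def power2_eq_square mult.assoc)
    then show ?thesis
      using semi.snorm_ge_0[OF x] by (simp add: real_sqrt_mult)
  qed
  then show ?thesis
    using that[of "sqrt K"] K(1) by simp
qed

section \<open>The A-adjoint\<close>

text \<open>The last part holds because the kernel of the symmetric operator \<open>A\<close> is orthogonal to the range of
  \<open>A\<close>, hence also to its closure. It is the reason why the range condition in the definition of the
  \<open>A\<close>-adjoint makes it unique.\<close>

lemma closure_range_properties:
  assumes A: "A \<in> positive_op"
  defines "M \<equiv> hmet.mtopology closure_of (A ` H)"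
  shows "M \<subseteq> H" "subspace M" "closedin hmet.mtopology M" "A ` H \<subseteq> M"
    and "\<lbrakk>x \<in> M; A x = 0\<rbrakk> \<Longrightarrow> x = 0"
proof -
  note AD = bounded_opD[OF positive_opD[OF A]]
  have AH: "A ` H \<subseteq> H" using AD by auto
  have "subspace (A ` H)"
  proof (rule subspaceI)
    have "A 0 = 0" using AD(3)[OF H_closed(1), of 0] by simp
    then show "0 \<in> A ` H" using H_closed(1) by (metis imageI)
    show "x + y \<in> A ` H" if "x \<in> A ` H" "y \<in> A ` H" for x y
      using that AD(2)[symmetric] by (auto simp: H_closed)
    show "scale c x \<in> A ` H" if "x \<in> A ` H" for c x
      using that AD(3)[symmetric] by (auto simp: H_closed)
  qed
  then show "subspace M" unfolding M_def using AH by (rule subspace_closure[rotated])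
  show MH: "M \<subseteq> H" using closure_of_subset_topspace[of hmet.mtopology "A ` H"] by (simp add: M_def)
  show "closedin hmet.mtopology M" by (simp add: M_def)
  show "A ` H \<subseteq> M" using closure_of_subset[of "A ` H" hmet.mtopology] AH by (simp add: M_def)
  show "x = 0" if x: "x \<in> M" and "A x = 0"
  proof -
    have xH: "x \<in> H" using x MH by auto
    have 0: "ip 0 y = 0" if "y \<in> H" for y
      using ip_scale_left[OF H_closed(1) that, of 0] by simp
    have "ip s x = 0" if "s \<in> A ` H" for s
    proof -
      from that obtain v where v: "v \<in> H" "s = A v" by blast
      then have "ip s x = ip v 0"
        using positive_op_symmetric[OF A v(1) xH] \<open>A x = 0\<close> by simp
      then show ?thesis
        using ip_commute[OF H_closed(1) v(1)] 0[OF v(1)] by simp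
    qed
    then have "ip x x = 0"
      using orthogonal_closure[OF AH _ xH] x by (simp add: M_def)
    then show ?thesis using ip_eq_zero[OF xH] by simp
  qed
qed

lemma A_adjoint_eqI:
  assumes A: "A \<in> positive_op"
    and S: "S \<in> bounded_op" "\<And>x. x \<in> H \<Longrightarrow> A (S x) = adjoint_op T (A x)"
      "S ` H \<subseteq> hmet.mtopology closure_of (A ` H)"
  shows "A_adjoint A T = S"
  unfolding A_adjoint_def
proof (rule the_equality)
  show "S \<in> bounded_op \<and> (\<forall>x\<in>H. A (S x) = adjoint_op T (A x)) \<and>
     S ` H \<subseteq> hmet.mtopology closure_of (A ` H)"
    using S by auto
  fix S' assume S': "S' \<in> bounded_op \<and> (\<forall>x\<in>H. A (S' x) = adjoint_op T (A x)) \<and>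
     S' ` H \<subseteq> hmet.mtopology closure_of (A ` H)"
  note AD = bounded_opD[OF positive_opD[OF A]]
  note R = closure_range_properties[OF A]
  show "S' = S"
  proof (rule bounded_op_eqI)
    fix x assume x: "x \<in> H"
    have H: "S' x \<in> H" "S x \<in> H" using S S' x bounded_opD by blast+
    have "A (S' x) = A ((S' x - S x) + S x)" by simp
    also have "\<dots> = A (S' x - S x) + A (S x)"
      using H by (intro AD(2)) (auto simp: H_closed)
    finally have "A (S' x - S x) = 0" using S S' x by simp
    moreover have "S' x - S x \<in> hmet.mtopology closure_of (A ` H)"
      using S S' x by (intro subspace_diff[OF R(2)]) auto
    ultimately show "S' x = S x" using R(5) by fastforce
  qed (use S S' in auto)
qed

text \<open>The projection \<open>P\<close> onto the closure of the range satisfies \<open>A P = A\<close>, because \<open>\<langle>v | APx\<rangle> = \<langle>Av | Px\<rangle>\<close>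
  and \<open>Av\<close> lies in the range. So \<open>P\<close> after any solution \<open>S\<^sub>0\<close> of \<open>A S\<^sub>0 = T\<^sup>* A\<close> is a solution with the
  required range.\<close>

lemma A_adjoint:
  assumes A: "A \<in> positive_op" and T: "T \<in> A_bounded_op A"
  shows "A_adjoint A T \<in> bounded_op"
    and "x \<in> H \<Longrightarrow> A (A_adjoint A T x) = adjoint_op T (A x)"
proof -
  define M where "M = hmet.mtopology closure_of (A ` H)"
  note AD = bounded_opD[OF positive_opD[OF A]]
  note R = closure_range_properties[OF A, folded M_def]
  obtain S0 where S0: "S0 \<in> bounded_op" "\<And>x. x \<in> H \<Longrightarrow> A (S0 x) = adjoint_op T (A x)"
    using T by (auto simp: A_bounded_op_def)
  have "\<exists>P\<in>bounded_op. P ` H \<subseteq> M \<and> (\<forall>m\<in>M. \<forall>x\<in>H. ip m (P x) = ip m x)"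
    using R(1) by (intro adjoint_from_closed_subspace[OF R(1-3), where K = 1]) auto
  then obtain P where P: "P \<in> bounded_op" "P ` H \<subseteq> M" "\<And>m x. \<lbrakk>m \<in> M; x \<in> H\<rbrakk> \<Longrightarrow> ip m (P x) = ip m x"
    by blast
  have AP: "A (P x) = A x" if x: "x \<in> H" for x
  proof (rule ip_eqI[where M = H])
    have Px: "P x \<in> H" using P x bounded_opD by blast
    show "ip v (A (P x)) = ip v (A x)" if v: "v \<in> H" for v
      using positive_op_symmetric[OF A v Px] positive_op_symmetric[OF A v x] P(3)[of "A v" x] R(4) v x
      by auto
    show "A (P x) \<in> H" "A x \<in> H" "A (P x) - A x \<in> H"
      using AD Px x by (auto simp: H_closed)
  qed
  have eq: "A_adjoint A T = (\<lambda>x\<in>H. P (S0 x))"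
  proof (rule A_adjoint_eqI[OF A])
    show "(\<lambda>x\<in>H. P (S0 x)) \<in> bounded_op"
      by (rule bounded_op_comp[OF P(1) S0(1)])
    show "A ((\<lambda>x\<in>H. P (S0 x)) x) = adjoint_op T (A x)" if "x \<in> H" for x
      using that S0 AP bounded_opD(1)[OF S0(1)] by simp
    show "(\<lambda>x\<in>H. P (S0 x)) ` H \<subseteq> hmet.mtopology closure_of (A ` H)"
      using P(2) bounded_opD(1)[OF S0(1)] by (auto simp: M_def)
  qed
  show "A_adjoint A T \<in> bounded_op"
    using eq bounded_op_comp[OF P(1) S0(1)] by simp
  show "A (A_adjoint A T x) = adjoint_op T (A x)" if "x \<in> H"
    using that eq S0 AP bounded_opD(1)[OF S0(1)] by simp
qed

lemma adjoint_pair_A_adjoint: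
  assumes A: "A \<in> positive_op" and T: "T \<in> A_bounded_op A"
  shows "complex_semi_inner_space.adjoint_pair H (A_ip A) T (A_adjoint A T)"
proof -
  note AD = bounded_opD[OF positive_opD[OF A]]
  have Tb: "T \<in> bounded_op" using T by (simp add: A_bounded_op_def)
  note TD = bounded_opD[OF Tb] and SD = bounded_opD[OF A_adjoint(1)[OF A T]]
  have "ip (A (T x)) y = ip (A x) (A_adjoint A T y)" if "x \<in> H" "y \<in> H" for x y
    using that TD SD AD positive_op_symmetric[OF A] adjoint_op(2)[OF Tb] A_adjoint(2)[OF A T] by simp
  then show ?thesis
    using TD SD complex_semi_inner_space.adjoint_pair_def[OF semi_inner_space_A_ip[OF A]]
    by (auto simp: A_ip_def)
qed

text \<open>The bound comes from \<open>B = ST\<close>: it is symmetric for the form, and its powers grow at most like the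
  powers of its norm bound \<open>K\<close>, also in the seminorm, which is dominated by the norm. Then
  \<open>\<parallel>Tx\<parallel>\<^sub>A\<^sup>2 = \<langle>Bx | x\<rangle>\<^sub>A \<le> K \<parallel>x\<parallel>\<^sub>A\<^sup>2\<close>.\<close>

lemma A_norm_bound:
  assumes A: "A \<in> positive_op" and TS: "T \<in> bounded_op" "S \<in> bounded_op"
    and pair: "complex_semi_inner_space.adjoint_pair H (A_ip A) T S"
  obtains C where "C \<ge> 0" "\<And>x. x \<in> H \<Longrightarrow> A_norm A (T x) \<le> C * A_norm A x"
proof -
  interpret g: complex_semi_inner_space scale H "A_ip A"
    by (rule semi_inner_space_A_ip[OF A])
  note norm = A_norm_eq_snorm[OF A]
  note D = g.adjoint_pairD[OF pair]
  define B where "B = (\<lambda>x\<in>H. S (T x))"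
  have Bb: "B \<in> bounded_op"
    unfolding B_def by (rule bounded_op_comp[OF TS(2,1)])
  have BB: "g.adjoint_pair B B"
    using D by (auto simp: g.adjoint_pair_def B_def)
  obtain K where K: "K > 0" "\<And>x. x \<in> H \<Longrightarrow> hnorm (B x) \<le> K * hnorm x"
    using bounded_op_bound[OF Bb] by metis
  obtain L where L: "L \<ge> 0" "\<And>x. x \<in> H \<Longrightarrow> A_norm A x \<le> L * hnorm x"
    using A_norm_le_hnorm[OF A] by metis
  have B_le: "A_norm A (B x) \<le> K * A_norm A x" if x: "x \<in> H" for x
  proof -
    have pow: "(B ^^ n) x \<in> H \<and> hnorm ((B ^^ n) x) \<le> K ^ n * hnorm x" for n
    proof (induction n)
      case (Suc n)
      then have "hnorm (B ((B ^^ n) x)) \<le> K * hnorm ((B ^^ n) x)"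
        using K(2) by blast
      also have "\<dots> \<le> K * (K ^ n * hnorm x)"
        using Suc K(1) by (intro mult_left_mono) auto
      finally have "hnorm (B ((B ^^ n) x)) \<le> K * (K ^ n * hnorm x)" .
      then show ?case using Suc bounded_opD(1)[OF Bb] by (simp add: mult.assoc)
    qed (use x in simp)
    have "A_norm A ((B ^^ n) x) \<le> (L * hnorm x) * K ^ n" for n
    proof -
      have "A_norm A ((B ^^ n) x) \<le> L * hnorm ((B ^^ n) x)"
        using L(2) pow by blast
      also have "\<dots> \<le> L * (K ^ n * hnorm x)"
        using pow L(1) by (intro mult_left_mono) auto
      finally show ?thesis by (simp add: mult_ac)
    qed
    then show ?thesis
      unfolding norm by (rule g.symmetric_bound_of_growth[OF BB x K(1)])
  qed
  have "A_norm A (T x) \<le> sqrt K * A_norm A x" if x: "x \<in> H" for x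
  proof (rule power2_le_imp_le)
    have "complex_of_real ((A_norm A (T x))\<^sup>2) = A_ip A (B x) x"
      using D x by (simp add: norm g.self_eq[symmetric] B_def)
    then have "(A_norm A (T x))\<^sup>2 = cmod (A_ip A (B x) x)"
      by (metis norm_of_real abs_power2)
    also have "\<dots> \<le> A_norm A (B x) * A_norm A x"
      using g.cauchy_schwarz[of "B x" x] x bounded_opD(1)[OF Bb] by (simp add: norm)
    also have "\<dots> \<le> K * A_norm A x * A_norm A x"
      using B_le[OF x] g.snorm_ge_0[OF x] by (simp add: norm mult_right_mono)
    also have "\<dots> = (sqrt K * A_norm A x)\<^sup>2"
      using K(1) by (simp add: power_mult_distrib power2_eq_square)
    finally show "(A_norm A (T x))\<^sup>2 \<le> (sqrt K * A_norm A x)\<^sup>2" .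
    show "0 \<le> sqrt K * A_norm A x"
      using K(1) g.snorm_ge_0[OF x] by (simp add: norm)
  qed
  then show ?thesis
    using that[of "sqrt K"] K(1) by simp
qed

section \<open>Bounds for the numerical radius\<close>

text \<open>The constant \<open>C\<close> witnesses that the supremum is taken over a bounded set.\<close>

lemma A_norm_le_A_op_norm:
  assumes "\<And>x. \<lbrakk>x \<in> H; A_norm A x = 1\<rbrakk> \<Longrightarrow> A_norm A (T x) \<le> C" "x \<in> H" "A_norm A x = 1"
  shows "A_norm A (T x) \<le> A_op_norm A T"
proof -
  have "bdd_above {A_norm A (T x) |x. x \<in> H \<and> A_norm A x = 1}"
    using assms(1) by (intro bdd_aboveI[of _ C]) auto
  then have "A_norm A (T x) \<le> Sup {A_norm A (T x) |x. x \<in> H \<and> A_norm A x = 1}"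
    using assms(2,3) by (intro cSup_upper) auto
  then show ?thesis
    using assms(2,3) by (auto simp: A_op_norm_def)
qed

lemma A_op_norm_least:
  assumes "\<And>x. \<lbrakk>x \<in> H; A_norm A x = 1\<rbrakk> \<Longrightarrow> A_norm A (T x) \<le> C" "0 \<le> C"
  shows "A_op_norm A T \<le> C"
  using assms unfolding A_op_norm_def by (auto intro!: cSup_least)

lemma form_le_A_num_radius:
  assumes "\<And>x. \<lbrakk>x \<in> H; A_norm A x = 1\<rbrakk> \<Longrightarrow> cmod (A_ip A (T x) x) \<le> C" "x \<in> H" "A_norm A x = 1"
  shows "cmod (A_ip A (T x) x) \<le> A_num_radius A T"
proof -
  have "bdd_above {cmod (A_ip A (T x) x) |x. x \<in> H \<and> A_norm A x = 1}"
    using assms(1) by (intro bdd_aboveI[of _ C]) auto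
  then have "cmod (A_ip A (T x) x) \<le> Sup {cmod (A_ip A (T x) x) |x. x \<in> H \<and> A_norm A x = 1}"
    using assms(2,3) by (intro cSup_upper) auto
  then show ?thesis
    using assms(2,3) by (auto simp: A_num_radius_def)
qed

lemma A_num_radius_least:
  assumes "\<And>x. \<lbrakk>x \<in> H; A_norm A x = 1\<rbrakk> \<Longrightarrow> cmod (A_ip A (T x) x) \<le> C" "0 \<le> C"
  shows "A_num_radius A T \<le> C"
  using assms unfolding A_num_radius_def by (auto intro!: cSup_least)

theorem A_num_radius_sq_bounds:
  assumes A: "A \<in> positive_op" and T: "T \<in> A_bounded_op A"
  shows "1/4 * A_op_norm A (A_anticomm A T) \<le> (A_num_radius A T)\<^sup>2"
    and "(A_num_radius A T)\<^sup>2 \<le> 1/2 * A_op_norm A (A_anticomm A T)"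
proof -
  interpret g: complex_semi_inner_space scale H "A_ip A"
    by (rule semi_inner_space_A_ip[OF A])
  note norm = A_norm_eq_snorm[OF A]
  define S where "S = A_adjoint A T"
  have Tb: "T \<in> bounded_op" using T by (simp add: A_bounded_op_def)
  have Sb: "S \<in> bounded_op" unfolding S_def by (rule A_adjoint(1)[OF A T])
  note TD = bounded_opD[OF Tb] and SD = bounded_opD[OF Sb]
  have pair: "g.adjoint_pair T S"
    unfolding S_def by (rule adjoint_pair_A_adjoint[OF A T])
  obtain C where C: "C \<ge> 0" "\<And>x. x \<in> H \<Longrightarrow> A_norm A (T x) \<le> C * A_norm A x"
    using A_norm_bound[OF A Tb Sb pair] by metis
  have form_C: "cmod (A_ip A (T x) x) \<le> C * (A_norm A x)\<^sup>2" if x: "x \<in> H" for x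
  proof -
    have "cmod (A_ip A (T x) x) \<le> A_norm A (T x) * A_norm A x"
      using g.cauchy_schwarz[OF TD(1)[OF x] x] by (simp add: norm)
    also have "\<dots> \<le> C * A_norm A x * A_norm A x"
      using C(2)[OF x] g.snorm_ge_0[OF x] by (simp add: norm mult_right_mono)
    finally show ?thesis by (simp add: power2_eq_square)
  qed
  define w where "w = A_num_radius A T"
  have form_w1: "cmod (A_ip A (T x) x) \<le> w" if "x \<in> H" "A_norm A x = 1" for x
    unfolding w_def using form_C that by (intro form_le_A_num_radius[where C = C]) force+
  have w0: "0 \<le> w"
  proof (cases "\<exists>x\<in>H. A_norm A x = 1")
    case True
    then show ?thesis using form_w1 norm_ge_zero order_trans by blast
  qed (auto simp: w_def A_num_radius_def)
  (* rescaling from seminorm 1; null vectors have to be treated by the bound with C *)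
  have form_w: "cmod (A_ip A (T x) x) \<le> w * (A_norm A x)\<^sup>2" if x: "x \<in> H" for x
  proof (cases "A_norm A x = 0")
    case True
    then show ?thesis using form_C[OF x] by simp
  next
    case False
    define n where "n = A_norm A x"
    have n: "n > 0" using False g.snorm_ge_0[OF x] by (simp add: n_def norm)
    define y where "y = scale (of_real (1 / n)) x"
    have y: "y \<in> H" using x by (simp add: y_def H_closed)
    have "A_norm A y = 1"
      using n g.snorm_scale[OF x] by (simp add: y_def norm[symmetric] n_def[symmetric] norm_divide)
    moreover have "A_ip A (T y) y = of_real ((1 / n)\<^sup>2) * A_ip A (T x) x"
      using x TD by (simp add: y_def g.scale_left g.scale_right H_closed power2_eq_square)
    ultimately have "cmod (of_real ((1 / n)\<^sup>2) * A_ip A (T x) x) \<le> w"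
      using form_w1[OF y] by simp
    then have "(1 / n)\<^sup>2 * cmod (A_ip A (T x) x) \<le> w"
      by (simp only: norm_mult norm_of_real abs_power2)
    then show ?thesis
      using n by (simp add: n_def[symmetric] field_simps)
  qed
  have anticomm: "A_anticomm A T x = S (T x) + T (S x)" if "x \<in> H" for x
    using that by (simp add: A_anticomm_def S_def)
  have le_w: "A_norm A (A_anticomm A T x) \<le> 4 * w\<^sup>2" if x: "x \<in> H" "A_norm A x = 1" for x
    using g.anticomm_le_form_sq[OF pair TD(2) SD(2) w0 _ x(1)] form_w x
    by (simp add: anticomm norm)
  show "1/4 * A_op_norm A (A_anticomm A T) \<le> (A_num_radius A T)\<^sup>2"
  proof -
    have "A_op_norm A (A_anticomm A T) \<le> 4 * w\<^sup>2"
      by (rule A_op_norm_least) (simp_all add: le_w)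
    then show ?thesis by (simp add: w_def)
  qed
  define N where "N = A_op_norm A (A_anticomm A T)"
  have le_N: "A_norm A (A_anticomm A T x) \<le> N" if "x \<in> H" "A_norm A x = 1" for x
    unfolding N_def by (rule A_norm_le_A_op_norm[where C = "4 * w\<^sup>2"]) (simp_all add: le_w that)
  have N0: "N \<ge> 0"
  proof (cases "\<exists>x\<in>H. A_norm A x = 1")
    case True
    then obtain x where x: "x \<in> H" "A_norm A x = 1" by blast
    have "0 \<le> A_norm A (A_anticomm A T x)"
      using x TD(1) SD(1) by (simp add: anticomm norm g.snorm_ge_0 H_closed)
    then show ?thesis using le_N[OF x] by linarith
  qed (auto simp: N_def A_op_norm_def)
  have "w \<le> sqrt (1/2 * N)"
    unfolding w_def
  proof (rule A_num_radius_least)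
    fix x assume x: "x \<in> H" "A_norm A x = 1"
    have "(cmod (A_ip A (T x) x))\<^sup>2 \<le> 1/2 * A_norm A (A_anticomm A T x)"
      using g.form_sq_le_anticomm[OF pair x(1)] x by (simp add: norm anticomm)
    also have "\<dots> \<le> 1/2 * N" using le_N[OF x] by simp
    finally show "cmod (A_ip A (T x) x) \<le> sqrt (1/2 * N)"
      by (rule real_le_rsqrt)
  qed (use N0 in simp)
  then have "w\<^sup>2 \<le> (sqrt (1/2 * N))\<^sup>2"
    using w0 by (rule power_mono)
  then show "(A_num_radius A T)\<^sup>2 \<le> 1/2 * A_op_norm A (A_anticomm A T)"
    using N0 by (simp add: w_def N_def)
qed

section \<open>Sharpness\<close>

definition id_op :: "'a \<Rightarrow> 'a" where
  "id_op = (\<lambda>x\<in>H. x)"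

lemma id_op_bounded: "id_op \<in> bounded_op"
  by (auto simp: bounded_op_def id_op_def H_closed intro!: exI[of _ 1])

lemma id_op_positive: "id_op \<in> positive_op"
  using id_op_bounded ip_ge_zero by (auto simp: positive_op_def id_op_def)

lemma A_ip_id_op: "x \<in> H \<Longrightarrow> A_ip id_op x y = ip x y"
  by (simp add: A_ip_def id_op_def)

lemma A_norm_id_op: "x \<in> H \<Longrightarrow> A_norm id_op x = hnorm x"
  by (simp add: A_norm_def A_ip_id_op hnorm_def)

lemma A_adjoint_id_op:
  assumes T: "T \<in> bounded_op" and S: "S \<in> bounded_op"
    and pair: "\<And>x y. \<lbrakk>x \<in> H; y \<in> H\<rbrakk> \<Longrightarrow> ip (T x) y = ip x (S y)"
  shows "T \<in> A_bounded_op id_op" "A_adjoint id_op T = S"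
proof -
  have adj: "adjoint_op T = S"
    using S pair by (rule adjoint_op_eqI)
  have eq: "id_op (S x) = adjoint_op T (id_op x)" if "x \<in> H" for x
    using that bounded_opD(1)[OF S] by (simp add: adj id_op_def)
  show "T \<in> A_bounded_op id_op"
    using T S eq by (auto simp: A_bounded_op_def)
  have "S ` H \<subseteq> hmet.mtopology closure_of (id_op ` H)"
    using bounded_opD(1)[OF S] closure_of_subset[of H hmet.mtopology] by (auto simp: id_op_def)
  then show "A_adjoint id_op T = S"
    using A_adjoint_eqI[OF id_op_positive S eq] by simp
qed

end

definition cscale :: "complex \<Rightarrow> (nat \<Rightarrow> complex) \<Rightarrow> nat \<Rightarrow> complex" where
  "cscale c f = (\<lambda>n. c * f n)"

text \<open>The space \<open>\<complex>\<^sup>2\<close>, embedded in the sequences because these are the ambient type over which the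
  best constants are quantified.\<close>

definition plane :: "(nat \<Rightarrow> complex) set" where
  "plane = {f. \<forall>n\<ge>2. f n = 0}"

definition plane_ip :: "(nat \<Rightarrow> complex) \<Rightarrow> (nat \<Rightarrow> complex) \<Rightarrow> complex" where
  "plane_ip f g = f 0 * cnj (g 0) + f 1 * cnj (g 1)"

lemma plane_ip_self: "plane_ip f f = of_real ((cmod (f 0))\<^sup>2 + (cmod (f 1))\<^sup>2)"
  using complex_norm_square[of "f 0"] complex_norm_square[of "f 1"] by (simp add: plane_ip_def)

lemma plane_inner_space: "complex_inner_space cscale plane plane_ip"
proof -
  interpret vector_space cscale
    by unfold_locales (auto simp: cscale_def fun_eq_iff algebra_simps)
  show ?thesis
  proof
    show "subspace plane"
      by (rule subspaceI) (auto simp: plane_def cscale_def)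
    show "x = 0" if x: "x \<in> plane" "plane_ip x x = 0" for x
    proof
      have "(cmod (x 0))\<^sup>2 + (cmod (x 1))\<^sup>2 = 0"
        using x(2) unfolding plane_ip_self by (metis of_real_eq_0_iff)
      then have "x 0 = 0" "x 1 = 0"
        by (simp_all add: sum_power2_eq_zero_iff)
      then show "x n = 0 n" for n
        using x(1) by (cases "n \<ge> 2") (auto simp: plane_def not_le less_2_cases_iff)
    qed
    show "plane_ip x x \<in> \<real>\<^sub>\<ge>\<^sub>0" for x
      unfolding plane_ip_self by (simp only: nonneg_Reals_of_real_iff) simp
  qed (simp_all add: plane_ip_def cscale_def algebra_simps)
qed

interpretation plane: complex_inner_space cscale plane plane_ip
  by (rule plane_inner_space)

lemma plane_hnorm: "plane.hnorm f = sqrt ((cmod (f 0))\<^sup>2 + (cmod (f 1))\<^sup>2)"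
  unfolding plane.hnorm_def plane_ip_self Re_complex_of_real ..

lemma plane_complete: "plane.hmet.mcomplete"
  unfolding plane.hmet.mcomplete_def
proof (intro allI impI)
  fix u assume u: "plane.hmet.MCauchy u"
  have up: "u k \<in> plane" for k
    using u by (auto simp: plane.hmet.MCauchy_def)
  have "convergent (\<lambda>k. u k i)" if i: "i = 0 \<or> i = 1" for i
  proof -
    have "Cauchy (\<lambda>k. u k i)"
    proof (rule metric_CauchyI)
      fix r :: real assume "r > 0"
      then obtain N where N: "\<And>j k. \<lbrakk>N \<le> j; N \<le> k\<rbrakk> \<Longrightarrow> plane.hdist (u j) (u k) < r"
        using u unfolding plane.hmet.MCauchy_def by blast
      have "dist (u j i) (u k i) < r" if "N \<le> j" "N \<le> k" for j k
      proof -
        have "dist (u j i) (u k i) \<le> plane.hdist (u j) (u k)"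
          using i up by (auto simp: plane.hdist_def plane_hnorm dist_norm intro: real_le_rsqrt)
        then show ?thesis using N[OF that] by simp
      qed
      then show "\<exists>N. \<forall>j\<ge>N. \<forall>k\<ge>N. dist (u j i) (u k i) < r" by blast
    qed
    then show ?thesis by (rule Cauchy_convergent)
  qed
  then obtain a b where ab: "(\<lambda>k. u k 0) \<longlonglongrightarrow> a" "(\<lambda>k. u k 1) \<longlonglongrightarrow> b"
    unfolding convergent_def by blast
  define z where "z = (\<lambda>n::nat. if n = 0 then a else if n = 1 then b else 0)"
  have z: "z \<in> plane" by (simp add: z_def plane_def)
  have "(\<lambda>k. sqrt ((cmod (u k 0 - a))\<^sup>2 + (cmod (u k 1 - b))\<^sup>2))
      \<longlonglongrightarrow> sqrt ((cmod (a - a))\<^sup>2 + (cmod (b - b))\<^sup>2)"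
    by (intro tendsto_intros ab)
  then have "(\<lambda>k. plane.hdist (u k) z) \<longlonglongrightarrow> 0"
    using up z by (simp add: plane.hdist_def plane_hnorm z_def)
  then have "limitin plane.hmet.mtopology u z sequentially"
    using up z by (simp add: plane.hmet.limitin_metric_dist_null)
  then show "\<exists>z. limitin plane.hmet.mtopology u z sequentially"
    by blast
qed

interpretation plane: complex_hilbert_space cscale plane plane_ip
  by unfold_locales (rule plane_complete)

definition unit_vec :: "nat \<Rightarrow> complex" where
  "unit_vec = (\<lambda>n. if n = 0 then 1 else 0)"

lemma unit_vec: "unit_vec \<in> plane" "plane.A_norm plane.id_op unit_vec = 1"
proof -
  show "unit_vec \<in> plane" by (simp add: unit_vec_def plane_def)
  then show "plane.A_norm plane.id_op unit_vec = 1"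
    by (simp add: plane.A_norm_id_op plane_hnorm unit_vec_def)
qed

definition lower_shift :: "(nat \<Rightarrow> complex) \<Rightarrow> nat \<Rightarrow> complex" where
  "lower_shift = (\<lambda>f\<in>plane. \<lambda>n. if n = 0 then f 1 else 0)"

definition raise_shift :: "(nat \<Rightarrow> complex) \<Rightarrow> nat \<Rightarrow> complex" where
  "raise_shift = (\<lambda>f\<in>plane. \<lambda>n. if n = 1 then f 0 else 0)"

lemma shift_bounded: "lower_shift \<in> plane.bounded_op" "raise_shift \<in> plane.bounded_op"
proof -
  have mem: "(\<lambda>n. if n = 0 then c else 0) \<in> plane" "(\<lambda>n. if n = 1 then c else 0) \<in> plane" for c
    by (auto simp: plane_def)
  have "plane.hnorm (lower_shift f) \<le> 1 * plane.hnorm f" "plane.hnorm (raise_shift f) \<le> 1 * plane.hnorm f"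
    if "f \<in> plane" for f
    using that by (simp_all add: plane_hnorm lower_shift_def raise_shift_def)
  then have bound: "\<exists>K. \<forall>f\<in>plane. plane.hnorm (lower_shift f) \<le> K * plane.hnorm f"
      "\<exists>K. \<forall>f\<in>plane. plane.hnorm (raise_shift f) \<le> K * plane.hnorm f"
    by blast+
  show "lower_shift \<in> plane.bounded_op" "raise_shift \<in> plane.bounded_op"
    using mem bound plane.H_closed(2,4) unfolding plane.bounded_op_def
    by (auto simp: lower_shift_def raise_shift_def fun_eq_iff cscale_def)
qed

text \<open>For a unit vector \<open>f\<close> the form is \<open>\<bar>f(0)\<bar> \<bar>f(1)\<bar>\<close> in modulus, and \<open>2 \<bar>f(0)\<bar> \<bar>f(1)\<bar> \<le> \<bar>f(0)\<bar>\<^sup>2 + \<bar>f(1)\<bar>\<^sup>2 = 1\<close>.\<close>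

lemma nilpotent_attains_lower_bound:
  shows "lower_shift \<in> plane.A_bounded_op plane.id_op"
    and "plane.A_op_norm plane.id_op (plane.A_anticomm plane.id_op lower_shift) = 1"
    and "(plane.A_num_radius plane.id_op lower_shift)\<^sup>2 \<le> 1/4"
proof -
  have mem: "lower_shift f \<in> plane" "raise_shift f \<in> plane" if "f \<in> plane" for f
    using that plane.bounded_opD(1) shift_bounded by blast+
  have pair: "plane_ip (lower_shift f) g = plane_ip f (raise_shift g)" if "f \<in> plane" "g \<in> plane" for f g
    using that by (simp add: plane_ip_def lower_shift_def raise_shift_def)
  note adj = plane.A_adjoint_id_op[OF shift_bounded pair]
  show "lower_shift \<in> plane.A_bounded_op plane.id_op"
    by (rule adj(1))
  have anti: "plane.A_anticomm plane.id_op lower_shift f = f" if f: "f \<in> plane" for f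
  proof
    show "plane.A_anticomm plane.id_op lower_shift f n = f n" for n
    proof -
      have "plane.A_anticomm plane.id_op lower_shift f n = (if n = 1 then f 1 else if n = 0 then f 0 else 0)"
        using f mem[OF f]
        by (simp add: plane.A_anticomm_def adj(2)) (simp add: lower_shift_def raise_shift_def)
      moreover have "f n = 0" if "n \<noteq> 0" "n \<noteq> 1"
        using f that by (simp add: plane_def)
      ultimately show ?thesis by simp
    qed
  qed
  show "plane.A_op_norm plane.id_op (plane.A_anticomm plane.id_op lower_shift) = 1"
  proof (rule antisym)
    show "plane.A_op_norm plane.id_op (plane.A_anticomm plane.id_op lower_shift) \<le> 1"
      by (rule plane.A_op_norm_least) (simp_all add: anti)
    show "1 \<le> plane.A_op_norm plane.id_op (plane.A_anticomm plane.id_op lower_shift)"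
      using plane.A_norm_le_A_op_norm[of plane.id_op "plane.A_anticomm plane.id_op lower_shift" 1 unit_vec]
        unit_vec by (simp add: anti)
  qed
  have form: "cmod (plane.A_ip plane.id_op (lower_shift f) f) \<le> 1/2"
    if f: "f \<in> plane" "plane.A_norm plane.id_op f = 1" for f
  proof -
    have "cmod (plane.A_ip plane.id_op (lower_shift f) f) = cmod (f 1) * cmod (f 0)"
      using f mem[OF f(1)] by (simp add: plane.A_ip_id_op plane_ip_def lower_shift_def norm_mult)
    moreover have "(cmod (f 0))\<^sup>2 + (cmod (f 1))\<^sup>2 = 1"
      using f by (simp add: plane.A_norm_id_op plane_hnorm)
    moreover have "0 \<le> (cmod (f 0) - cmod (f 1))\<^sup>2"
      by simp
    ultimately show ?thesis
      by (simp add: power2_diff mult_ac)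
  qed
  have "0 \<le> plane.A_num_radius plane.id_op lower_shift"
    using plane.form_le_A_num_radius[OF form unit_vec] norm_ge_zero order_trans by blast
  moreover have "plane.A_num_radius plane.id_op lower_shift \<le> 1/2"
    by (rule plane.A_num_radius_least[OF form]) simp_all
  ultimately have "(plane.A_num_radius plane.id_op lower_shift)\<^sup>2 \<le> (1/2)\<^sup>2"
    by (intro power_mono)
  then show "(plane.A_num_radius plane.id_op lower_shift)\<^sup>2 \<le> 1/4"
    by (simp add: power2_eq_square)
qed

lemma identity_attains_upper_bound:
  shows "plane.id_op \<in> plane.A_bounded_op plane.id_op"
    and "plane.A_op_norm plane.id_op (plane.A_anticomm plane.id_op plane.id_op) = 2"
    and "1 \<le> plane.A_num_radius plane.id_op plane.id_op"
proof -
  have pair: "plane_ip (plane.id_op f) g = plane_ip f (plane.id_op g)" if "f \<in> plane" "g \<in> plane" for f g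
    using that by (simp add: plane.id_op_def)
  have id: "plane.id_op f = f" if "f \<in> plane" for f
    using that by (simp add: plane.id_op_def)
  note adj = plane.A_adjoint_id_op[OF plane.id_op_bounded plane.id_op_bounded pair]
  show "plane.id_op \<in> plane.A_bounded_op plane.id_op"
    by (rule adj(1))
  interpret g: complex_semi_inner_space cscale plane "plane.A_ip plane.id_op"
    by (rule plane.semi_inner_space_A_ip[OF plane.id_op_positive])
  have anti: "plane.A_norm plane.id_op (plane.A_anticomm plane.id_op plane.id_op f) = 2"
    if f: "f \<in> plane" "plane.A_norm plane.id_op f = 1" for f
  proof -
    have "plane.A_anticomm plane.id_op plane.id_op f = f + f"
      using f by (simp add: plane.A_anticomm_def adj(2) id)
    also have "\<dots> = cscale 2 f"
      by (rule ext) (simp add: cscale_def)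
    finally show ?thesis
      using f g.snorm_scale[of f 2] by (simp add: plane.A_norm_eq_snorm[OF plane.id_op_positive])
  qed
  show "plane.A_op_norm plane.id_op (plane.A_anticomm plane.id_op plane.id_op) = 2"
  proof (rule antisym)
    show "plane.A_op_norm plane.id_op (plane.A_anticomm plane.id_op plane.id_op) \<le> 2"
      by (rule plane.A_op_norm_least) (simp_all add: anti)
    show "2 \<le> plane.A_op_norm plane.id_op (plane.A_anticomm plane.id_op plane.id_op)"
      using plane.A_norm_le_A_op_norm[of plane.id_op "plane.A_anticomm plane.id_op plane.id_op" 2 unit_vec]
        unit_vec anti by simp
  qed
  have form: "plane.A_ip plane.id_op (plane.id_op f) f = 1"
    if f: "f \<in> plane" "plane.A_norm plane.id_op f = 1" for f
    using f g.self_eq[OF f(1)] by (simp add: plane.A_norm_eq_snorm[OF plane.id_op_positive] id)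
  have "cmod (plane.A_ip plane.id_op (plane.id_op unit_vec) unit_vec)
      \<le> plane.A_num_radius plane.id_op plane.id_op"
    by (rule plane.form_le_A_num_radius[where C = 1]) (simp_all add: form unit_vec)
  then show "1 \<le> plane.A_num_radius plane.id_op plane.id_op"
    using form[OF unit_vec] by simp
qed

theorem theorem2p1:
  shows
    "(\<forall>(scale :: complex \<Rightarrow> 'a::ab_group_add \<Rightarrow> 'a) H ip A T.
        complex_hilbert_space scale H ip \<longrightarrow>
        A \<in> complex_hilbert_space.positive_op scale H ip \<longrightarrow>
        T \<in> complex_hilbert_space.A_bounded_op scale H ip A \<longrightarrow>
          1/4 * complex_hilbert_space.A_op_norm H ip A
                  (complex_hilbert_space.A_anticomm scale H ip A T)
            \<le> (complex_hilbert_space.A_num_radius H ip A T)\<^sup>2 \<and>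
          (complex_hilbert_space.A_num_radius H ip A T)\<^sup>2
            \<le> 1/2 * complex_hilbert_space.A_op_norm H ip A
                      (complex_hilbert_space.A_anticomm scale H ip A T))
     \<and>
     (\<forall>c::real.
        (\<forall>(scale :: complex \<Rightarrow> (nat \<Rightarrow> complex) \<Rightarrow> (nat \<Rightarrow> complex)) H ip A T.
           complex_hilbert_space scale H ip \<longrightarrow>
           A \<in> complex_hilbert_space.positive_op scale H ip \<longrightarrow>
           T \<in> complex_hilbert_space.A_bounded_op scale H ip A \<longrightarrow>
             c * complex_hilbert_space.A_op_norm H ip A
                   (complex_hilbert_space.A_anticomm scale H ip A T)
               \<le> (complex_hilbert_space.A_num_radius H ip A T)\<^sup>2)
        \<longrightarrow> c \<le> 1/4)
     \<and>
     (\<forall>c::real.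
        (\<forall>(scale :: complex \<Rightarrow> (nat \<Rightarrow> complex) \<Rightarrow> (nat \<Rightarrow> complex)) H ip A T.
           complex_hilbert_space scale H ip \<longrightarrow>
           A \<in> complex_hilbert_space.positive_op scale H ip \<longrightarrow>
           T \<in> complex_hilbert_space.A_bounded_op scale H ip A \<longrightarrow>
             (complex_hilbert_space.A_num_radius H ip A T)\<^sup>2
               \<le> c * complex_hilbert_space.A_op_norm H ip A
                       (complex_hilbert_space.A_anticomm scale H ip A T))
        \<longrightarrow> 1/2 \<le> c)"
proof (intro conjI allI impI)
  fix scale :: "complex \<Rightarrow> 'a \<Rightarrow> 'a" and H ip A T
  assume "complex_hilbert_space scale H ip"
  then interpret complex_hilbert_space scale H ip .
  assume "A \<in> positive_op" "T \<in> A_bounded_op A"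
  then show "1/4 * A_op_norm A (A_anticomm A T) \<le> (A_num_radius A T)\<^sup>2"
    and "(A_num_radius A T)\<^sup>2 \<le> 1/2 * A_op_norm A (A_anticomm A T)"
    by (rule A_num_radius_sq_bounds)+
next
  fix c :: real
  assume hyp: "\<forall>(scale :: complex \<Rightarrow> (nat \<Rightarrow> complex) \<Rightarrow> (nat \<Rightarrow> complex)) H ip A T.
     complex_hilbert_space scale H ip \<longrightarrow>
     A \<in> complex_hilbert_space.positive_op scale H ip \<longrightarrow>
     T \<in> complex_hilbert_space.A_bounded_op scale H ip A \<longrightarrow>
       c * complex_hilbert_space.A_op_norm H ip A (complex_hilbert_space.A_anticomm scale H ip A T)
         \<le> (complex_hilbert_space.A_num_radius H ip A T)\<^sup>2"
  have "c * plane.A_op_norm plane.id_op (plane.A_anticomm plane.id_op lower_shift)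
      \<le> (plane.A_num_radius plane.id_op lower_shift)\<^sup>2"
    by (rule hyp[rule_format, OF plane.complex_hilbert_space_axioms plane.id_op_positive
          nilpotent_attains_lower_bound(1)])
  then show "c \<le> 1/4"
    using nilpotent_attains_lower_bound(2,3) by simp
next
  fix c :: real
  assume hyp: "\<forall>(scale :: complex \<Rightarrow> (nat \<Rightarrow> complex) \<Rightarrow> (nat \<Rightarrow> complex)) H ip A T.
     complex_hilbert_space scale H ip \<longrightarrow>
     A \<in> complex_hilbert_space.positive_op scale H ip \<longrightarrow>
     T \<in> complex_hilbert_space.A_bounded_op scale H ip A \<longrightarrow>
       (complex_hilbert_space.A_num_radius H ip A T)\<^sup>2
         \<le> c * complex_hilbert_space.A_op_norm H ip A (complex_hilbert_space.A_anticomm scale H ip A T)"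
  have upper: "(plane.A_num_radius plane.id_op plane.id_op)\<^sup>2
      \<le> c * plane.A_op_norm plane.id_op (plane.A_anticomm plane.id_op plane.id_op)"
    by (rule hyp[rule_format, OF plane.complex_hilbert_space_axioms plane.id_op_positive
          identity_attains_upper_bound(1)])
  have "1 \<le> (plane.A_num_radius plane.id_op plane.id_op)\<^sup>2"
    using identity_attains_upper_bound(3) by (simp add: one_le_power)
  then show "1/2 \<le> c"
    using upper identity_attains_upper_bound(2) by simp
qed

end
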